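(* Fix an integer $n\ge 1$. (i) Let $m_1,m_2,k_1,k_2$ be integers with $1\le m_1\le m_2$ and $0\le k_1\le k_2$. The mappings $\phi_{(m_2,m_1)}:\Lambda_{m_2,\cdot}\to\Lambda_{m_1,\cdot}$ and $\psi_{(k_2,k_1)}:\Lambda_{\cdot,k_2}\to\Lambda_{\cdot,k_1}$ whose degree-$r$ components ($r\ge 0$) are $$\phi^r_{(m_2,m_1)}=h^r_{m_1+1}\circ h^r_{m_1+2}\circ\dots\circ h^r_{m_2},\qquad \psi^r_{(k_2,k_1)}=v^r_{k_1+1}\circ v^r_{k_1+2}\circ\dots\circ v^r_{k_2}$$ (the identity if $m_1=m_2$, respectively $k_1=k_2$) are surjective homomorphisms of graded rings, and $(\phi_{(m_2,m_1)})$ and $(\psi_{(k_2,k_1)})$ are directed families of homomorphisms of graded rings. Furthermore, the inverse limits induced by these families are equal (up to canonical isomorphism of graded rings): $$\varprojlim_{m}\Lambda_{m,\cdot}=\Lambda=\varprojlim_{k}\Lambda_{\cdot,k}.$$ (ii) For every integer $m\ge 1$ the mapping $H_m:\Lambda\to\Lambda_{m,\cdot}$ defined by setting $\mathbf a_{p\mu_1\dots\mu_d}=0$ for all $p>m$, all $d\ge 0$ and all $\mu_i$ is a surjective homomorphism of graded rings. For every integer $k\ge 0$ the mapping $V_k:\Lambda\to\Lambda_{\cdot,k}$ defined by setting $\mathbf a_{p\mu_1\dots\mu_d}=0$ for all $p\ge 1$, all $d>k$ and all $\mu_i$ is a surjective homomorphism of graded rings.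
   Context: Indeterminates: for integers $p\ge 1$, $d\ge 0$ and $1\le\mu_1,\dots,\mu_d\le n$ let $\mathbf a_{p\mu_1\dots\mu_d}$ be independent indeterminates (for $d=0$ this is $\mathbf a_p$). For $m\ge1$, $k\ge0$, $\Lambda_{m,k}$ is the graded ring of symmetric polynomials with coefficients in $\mathbb Z$ in the $mq_k$ indeterminates $\mathbf a_{p\mu_1\dots\mu_d}$ with $1\le p\le m$, $0\le d\le k$ (invariant under all permutations of these $mq_k$ indeterminates), where $q_k=\sum_{j=0}^k n^j$. $\Lambda_{m,k}^r$ is the additive group of homogeneous elements of degree $r$ (including $0$), so $\Lambda_{m,k}=\bigoplus_{r\ge0}\Lambda^r_{m,k}$. Projections: $h_{m+1,k}^r:\Lambda_{m+1,k}^r\to\Lambda_{m,k}^r$ sets $\mathbf a_{(m+1)\mu_1\dots\mu_d}=0$ for all $0\le d\le k$ and all $\mu_i$; $v_{m,k+1}^r:\Lambda_{m,k+1}^r\to\Lambda_{m,k}^r$ sets $\mathbf a_{p\mu_1\dots\mu_{k+1}}=0$ for all $1\le p\le m$ and all $\mu_i$. One-index limits: $\Lambda^r_{\cdot,k}=\varprojlim_m\Lambda^r_{m,k}$ (along the $h^r_{m,k}$, $m\ge 1$) and $\Lambda^r_{m,\cdot}=\varprojlim_k\Lambda^r_{m,k}$ (along the $v^r_{m,k}$, $k\ge 0$), realized as groups of compatible sequences; $\Lambda_{\cdot,k}=\bigoplus_{r\ge0}\Lambda_{\cdot,k}^r$ and $\Lambda_{m,\cdot}=\bigoplus_{r\ge0}\Lambda_{m,\cdot}^r$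 are graded rings. For $m\ge 2$, $h_m^r:\Lambda^r_{m,\cdot}\to\Lambda^r_{m-1,\cdot}$ is $(P_{m,k})_k\mapsto(h^r_{m,k}P_{m,k})_k$; for $k\ge 1$, $v_k^r:\Lambda^r_{\cdot,k}\to\Lambda^r_{\cdot,k-1}$ is $(P_{m,k})_m\mapsto(v^r_{m,k}P_{m,k})_m$. A directed family over a directed set $I$ is a family of morphisms $f_{(j,i)}:A_j\to A_i$ for $i\le j$ with $f_{(i,i)}=\mathrm{id}$ and $f_{(l,i)}\circ f_{(j,l)}=f_{(j,i)}$ for $i\le l\le j$. Inverse limits of graded rings are taken in the category of graded rings, i.e. the degree-$r$ component of the limit is the inverse limit of the degree-$r$ components, and the limit is the direct sum of these over $r\geq 0$. $\Lambda$ is the graded ring of symmetric functions over $\mathbb Z$ (the direct sum over $r$ of the inverse limits of the groups of homogeneous symmetric polynomials of degree $r$ in finitely many variables), where the countably many variables are taken to be all the $\mathbf a_{p\mu_1\dots\mu_d}$. "Canonical" means compatible with the projections to the rings $\Lambda_{m,k}$ obtained by setting to zero all the other indeterminates. An element of $\Lambda$ in which indeterminates have been set to zero is viewed in $\Lambda_{m,\cdot}$ or $\Lambda_{\cdot,k}$ as the sequence of its truncations. *)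

theory Defs
  imports
    "HOL-Algebra.QuotRing"
    "HOL-Combinatorics.Permutations"
    "HOL-Library.Poly_Mapping"
begin

section \<open>Graded rings and their inverse limits\<close>

text \<open>The field \<open>homog\<close> gives the additive group of homogeneous elements of each degree.\<close>

record 'a gring = "'a ring" +
  homog :: "nat \<Rightarrow> 'a set"

locale graded_ring = ring R for R :: "('a, 'm) gring_scheme" (structure) +
  assumes homog_subgroup: "subgroup (homog R r) (add_monoid R)"
    and one_homog: "\<one> \<in> homog R 0"
    and mult_homog: "\<lbrakk>x \<in> homog R i; y \<in> homog R j\<rbrakk> \<Longrightarrow> x \<otimes> y \<in> homog R (i + j)"
    and homog_decomposition:
      "x \<in> carrier R \<Longrightarrow>
        \<exists>!f. (\<forall>r. f r \<in> homog R r) \<and> finite {r. f r \<noteq> \<zero>} \<and> x = (\<Oplus>r\<in>{r. f r \<noteq> \<zero>}. f r)"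

definition graded_ring_hom ::
    "('a, 'm) gring_scheme \<Rightarrow> ('b, 'n) gring_scheme \<Rightarrow> ('a \<Rightarrow> 'b) \<Rightarrow> bool" where
  "graded_ring_hom R S h \<longleftrightarrow>
     graded_ring R \<and> graded_ring S \<and> h \<in> ring_hom R S \<and> (\<forall>r. h ` homog R r \<subseteq> homog S r)"

definition surj_graded_ring_hom ::
    "('a, 'm) gring_scheme \<Rightarrow> ('b, 'n) gring_scheme \<Rightarrow> ('a \<Rightarrow> 'b) \<Rightarrow> bool" where
  "surj_graded_ring_hom R S h \<longleftrightarrow> graded_ring_hom R S h \<and> h ` carrier R = carrier S"

definition graded_ring_iso ::
    "('a, 'm) gring_scheme \<Rightarrow> ('b, 'n) gring_scheme \<Rightarrow> ('a \<Rightarrow> 'b) \<Rightarrow> bool" where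
  "graded_ring_iso R S h \<longleftrightarrow>
     graded_ring R \<and> graded_ring S \<and> h \<in> ring_iso R S \<and> (\<forall>r. h ` homog R r = homog S r)"

text \<open>In all families below, \<open>f j i\<close> is the transition map from \<open>A j\<close> to \<open>A i\<close> for \<open>i \<le> j\<close>.\<close>

definition directed_graded_family ::
    "'i::order set \<Rightarrow> ('i \<Rightarrow> ('a, 'm) gring_scheme) \<Rightarrow> ('i \<Rightarrow> 'i \<Rightarrow> 'a \<Rightarrow> 'a) \<Rightarrow> bool" where
  "directed_graded_family I A f \<longleftrightarrow>
     I \<noteq> {} \<and> (\<forall>i\<in>I. \<forall>j\<in>I. \<exists>l\<in>I. i \<le> l \<and> j \<le> l) \<and>
     (\<forall>i\<in>I. \<forall>j\<in>I. i \<le> j \<longrightarrow> graded_ring_hom (A j) (A i) (f j i)) \<and>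
     (\<forall>i\<in>I. \<forall>x\<in>carrier (A i). f i i x = x) \<and>
     (\<forall>i\<in>I. \<forall>j\<in>I. \<forall>l\<in>I. i \<le> j \<longrightarrow> j \<le> l \<longrightarrow>
        (\<forall>x\<in>carrier (A l). f j i (f l j x) = f l i x))"

text \<open>
  The degree-\<open>r\<close> part of the limit consists of the compatible families of homogeneous elements of
  degree \<open>r\<close>. The limit is the direct sum of these parts, realized inside the product of the rings
  \<open>A i\<close>: its elements are the finite sums of compatible homogeneous families. Since each \<open>A i\<close> is
  graded, the degree-\<open>r\<close> summand of such a sum is determined by the sum.
\<close>

definition lim_homog ::
    "'i::order set \<Rightarrow> ('i \<Rightarrow> ('a, 'm) gring_scheme) \<Rightarrow> ('i \<Rightarrow> 'i \<Rightarrow> 'a \<Rightarrow> 'a) \<Rightarrow> nat \<Rightarrow> ('i \<Rightarrow> 'a) set" where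
  "lim_homog I A f r =
     {x \<in> \<Pi>\<^sub>E i\<in>I. homog (A i) r. \<forall>i\<in>I. \<forall>j\<in>I. i \<le> j \<longrightarrow> f j i (x j) = x i}"

definition graded_lim ::
    "'i::order set \<Rightarrow> ('i \<Rightarrow> ('a, 'm) gring_scheme) \<Rightarrow> ('i \<Rightarrow> 'i \<Rightarrow> 'a \<Rightarrow> 'a) \<Rightarrow> ('i \<Rightarrow> 'a) gring" where
  "graded_lim I A f =
    (let zr = (\<lambda>i\<in>I. \<zero>\<^bsub>A i\<^esub>) in
     \<lparr>carrier =
        {x. \<exists>g. (\<forall>r. g r \<in> lim_homog I A f r) \<and> finite {r. g r \<noteq> zr} \<and>
                x = (\<lambda>i\<in>I. \<Oplus>\<^bsub>A i\<^esub>r\<in>{r. g r \<noteq> zr}. g r i)},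
      monoid.mult = (\<lambda>x y. \<lambda>i\<in>I. x i \<otimes>\<^bsub>A i\<^esub> y i),
      one = (\<lambda>i\<in>I. \<one>\<^bsub>A i\<^esub>),
      zero = zr,
      add = (\<lambda>x y. \<lambda>i\<in>I. x i \<oplus>\<^bsub>A i\<^esub> y i),
      homog = lim_homog I A f\<rparr>)"

text \<open>
  For one-step maps \<open>g j\<close> from \<open>A j\<close> to \<open>A (j - 1)\<close>, the composite
  \<open>g (i + 1) \<circ> g (i + 2) \<circ> \<dots> \<circ> g j\<close> from \<open>A j\<close> to \<open>A i\<close>.
\<close>

definition chain :: "(nat \<Rightarrow> 'a \<Rightarrow> 'a) \<Rightarrow> nat \<Rightarrow> nat \<Rightarrow> 'a \<Rightarrow> 'a" where
  "chain g j i = foldr (\<circ>) (map g [Suc i..<Suc j]) id"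

lemma chain_refl: "chain g i i = id"
  by (simp add: chain_def)

lemma chain_Suc: "i \<le> j \<Longrightarrow> chain g (Suc j) i = chain g j i \<circ> g (Suc j)"
proof -
  have acc: "foldr (\<circ>) fs h = foldr (\<circ>) fs id \<circ> h" for fs and h :: "'a \<Rightarrow> 'a"
    by (induction fs) (auto simp: comp_assoc)
  assume "i \<le> j"
  then have "[Suc i..<Suc (Suc j)] = [Suc i..<Suc j] @ [Suc j]"
    by simp
  then show ?thesis
    unfolding chain_def using acc[of "map g [Suc i..<Suc j]" "g (Suc j)"]
    by (simp del: upt_Suc)
qed


section \<open>Symmetric polynomials over the integers\<close>

type_synonym 'x zpoly = "('x \<Rightarrow>\<^sub>0 nat) \<Rightarrow>\<^sub>0 int"

definition pvar :: "'x \<Rightarrow> 'x zpoly" where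
  "pvar x = Poly_Mapping.single (Poly_Mapping.single x 1) 1"

definition psubst :: "('x \<Rightarrow> 'y zpoly) \<Rightarrow> 'x zpoly \<Rightarrow> 'y zpoly" where
  "psubst \<sigma> P =
     (\<Sum>t\<in>Poly_Mapping.keys P. of_int (Poly_Mapping.lookup P t) *
        (\<Prod>x\<in>Poly_Mapping.keys t. \<sigma> x ^ Poly_Mapping.lookup t x))"

definition set_zero :: "'x set \<Rightarrow> 'x zpoly \<Rightarrow> 'x zpoly" where
  "set_zero Z = psubst (\<lambda>x. if x \<in> Z then 0 else pvar x)"

definition pvars :: "'x zpoly \<Rightarrow> 'x set" where
  "pvars P = (\<Union>t\<in>Poly_Mapping.keys P. Poly_Mapping.keys t)"

definition homogeneous :: "nat \<Rightarrow> 'x zpoly \<Rightarrow> bool" where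
  "homogeneous r P \<longleftrightarrow>
     (\<forall>t\<in>Poly_Mapping.keys P. (\<Sum>x\<in>Poly_Mapping.keys t. Poly_Mapping.lookup t x) = r)"

definition sym_polys :: "'x set \<Rightarrow> 'x zpoly set" where
  "sym_polys S = {P. pvars P \<subseteq> S \<and> (\<forall>\<pi>. \<pi> permutes S \<longrightarrow> psubst (\<lambda>x. pvar (\<pi> x)) P = P)}"

definition sym_ring :: "'x set \<Rightarrow> 'x zpoly gring" where
  "sym_ring S =
     \<lparr>carrier = sym_polys S, monoid.mult = (*), one = 1, zero = 0, add = (+),
      homog = (\<lambda>r. {P \<in> sym_polys S. homogeneous r P})\<rparr>"

text \<open>
  Symmetric functions in the variables \<open>X\<close>: no enumeration of \<open>X\<close> is chosen, the limit is taken over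
  all finite subsets of \<open>X\<close> ordered by inclusion.
\<close>

definition sym_functions :: "'x set \<Rightarrow> ('x set \<Rightarrow> 'x zpoly) gring" where
  "sym_functions X = graded_lim {S. finite S \<and> S \<subseteq> X} sym_ring (\<lambda>T S. set_zero (T - S))"

text \<open>
  Setting possibly infinitely many variables to zero in a symmetric function, done in each finite
  truncation. The result is a compatible family of polynomials that are in general not symmetric in
  all of \<open>X\<close>.
\<close>

definition set_zero_family :: "'x set \<Rightarrow> ('x set \<Rightarrow> 'x zpoly) \<Rightarrow> 'x set \<Rightarrow> 'x zpoly" where
  "set_zero_family Z F = (\<lambda>S. set_zero Z (F S))"


section \<open>The rings attached to the indexed indeterminates\<close>

text \<open>The pair \<open>(p, [\<mu>\<^sub>1, \<dots>, \<mu>\<^sub>d])\<close> stands for the indeterminate \<open>a\<close> with indices \<open>p \<mu>\<^sub>1 \<dots> \<mu>\<^sub>d\<close>.\<close>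

type_synonym index = "nat \<times> nat list"

definition indets :: "nat \<Rightarrow> index set" where
  "indets n = {(p, \<mu>). 1 \<le> p \<and> set \<mu> \<subseteq> {1..n}}"

definition indets_upto :: "nat \<Rightarrow> nat \<Rightarrow> nat \<Rightarrow> index set" where
  "indets_upto n m k = {(p, \<mu>) \<in> indets n. p \<le> m \<and> length \<mu> \<le> k}"

definition Lam_fin :: "nat \<Rightarrow> nat \<Rightarrow> nat \<Rightarrow> index zpoly gring" where
  "Lam_fin n m k = sym_ring (indets_upto n m k)"

definition Lam :: "nat \<Rightarrow> (index set \<Rightarrow> index zpoly) gring" where
  "Lam n = sym_functions (indets n)"

text \<open>
  \<open>h_fin n k m\<close> maps \<open>Lam_fin n m k\<close> to \<open>Lam_fin n (m - 1) k\<close>, and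
  \<open>v_fin n m k\<close> maps \<open>Lam_fin n m k\<close> to \<open>Lam_fin n m (k - 1)\<close>.
\<close>

definition h_fin :: "nat \<Rightarrow> nat \<Rightarrow> nat \<Rightarrow> index zpoly \<Rightarrow> index zpoly" where
  "h_fin n k m = set_zero {(p, \<mu>) \<in> indets n. p = m \<and> length \<mu> \<le> k}"

definition v_fin :: "nat \<Rightarrow> nat \<Rightarrow> nat \<Rightarrow> index zpoly \<Rightarrow> index zpoly" where
  "v_fin n m k = set_zero {(p, \<mu>) \<in> indets n. p \<le> m \<and> length \<mu> = k}"

text \<open>\<open>Lam_m n m\<close> is the limit over \<open>k \<ge> 0\<close>, \<open>Lam_k n k\<close> the limit over \<open>m \<ge> 1\<close>.\<close>

definition Lam_m :: "nat \<Rightarrow> nat \<Rightarrow> (nat \<Rightarrow> index zpoly) gring" where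
  "Lam_m n m = graded_lim UNIV (\<lambda>k. Lam_fin n m k) (chain (v_fin n m))"

definition Lam_k :: "nat \<Rightarrow> nat \<Rightarrow> (nat \<Rightarrow> index zpoly) gring" where
  "Lam_k n k = graded_lim {1..} (\<lambda>m. Lam_fin n m k) (chain (h_fin n k))"

definition h_seq :: "nat \<Rightarrow> nat \<Rightarrow> (nat \<Rightarrow> index zpoly) \<Rightarrow> (nat \<Rightarrow> index zpoly)" where
  "h_seq n m P = (\<lambda>k. h_fin n k m (P k))"

definition v_seq :: "nat \<Rightarrow> nat \<Rightarrow> (nat \<Rightarrow> index zpoly) \<Rightarrow> (nat \<Rightarrow> index zpoly)" where
  "v_seq n k P = (\<lambda>m\<in>{1..}. v_fin n m k (P m))"

text \<open>
  Both maps are the ring-level ones; in every degree \<open>r\<close> they restrict to the composites of the maps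
  \<open>h\<^sup>r\<close> and \<open>v\<^sup>r\<close>, whose defining formulas do not depend on \<open>r\<close>.
\<close>

definition phi :: "nat \<Rightarrow> nat \<Rightarrow> nat \<Rightarrow> (nat \<Rightarrow> index zpoly) \<Rightarrow> (nat \<Rightarrow> index zpoly)" where
  "phi n m2 m1 = chain (h_seq n) m2 m1"

definition psi :: "nat \<Rightarrow> nat \<Rightarrow> nat \<Rightarrow> (nat \<Rightarrow> index zpoly) \<Rightarrow> (nat \<Rightarrow> index zpoly)" where
  "psi n k2 k1 = chain (v_seq n) k2 k1"

definition lim_Lam_m :: "nat \<Rightarrow> (nat \<Rightarrow> nat \<Rightarrow> index zpoly) gring" where
  "lim_Lam_m n = graded_lim {1..} (Lam_m n) (phi n)"

definition lim_Lam_k :: "nat \<Rightarrow> (nat \<Rightarrow> nat \<Rightarrow> index zpoly) gring" where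
  "lim_Lam_k n = graded_lim UNIV (Lam_k n) (psi n)"

text \<open>
  After some indeterminates have been set to zero, the resulting family is turned into the sequence
  of its truncations to the finite sets of indeterminates of \<open>Lam_fin n m k\<close>.
\<close>

definition H_map :: "nat \<Rightarrow> nat \<Rightarrow> (index set \<Rightarrow> index zpoly) \<Rightarrow> (nat \<Rightarrow> index zpoly)" where
  "H_map n m F =
     (\<lambda>k. set_zero_family {(p, \<mu>) \<in> indets n. m < p} F (indets_upto n m k))"

definition V_map :: "nat \<Rightarrow> nat \<Rightarrow> (index set \<Rightarrow> index zpoly) \<Rightarrow> (nat \<Rightarrow> index zpoly)" where
  "V_map n k F =
     (\<lambda>m\<in>{1..}. set_zero_family {(p, \<mu>) \<in> indets n. k < length \<mu>} F (indets_upto n m k))"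

end

theory Submission
  imports Defs
begin

text \<open>
  A symmetric polynomial in a finite set \<open>S\<close> of variables is a function on exponent types (multisets
  of positive exponents): the coefficient of a monomial depends only on its type. In degree at most
  \<open>D\<close> every type is realized in \<open>S\<close> once \<open>S\<close> has \<open>D\<close> elements. Hence the limit along any directed
  system of finite variable sets of unbounded size is parametrized by the same data, the functions of
  bounded degree on exponent types, where setting variables to zero fixes the parameter. All maps of
  the theorem therefore act as the identity on parameters, and surjectivity and the isomorphisms
  follow.
\<close>

section \<open>Inverse limits of graded rings\<close>

text \<open>Between polynomial rings in finitely many variables, setting variables to zero loses
  information: the product of all variables is killed as soon as one of them is. A symmetric
  polynomial therefore has many symmetric lifts to more variables, and lifting the components of a
  limit element one at a time leaves open whether the lifts are compatible. A parameter on types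
  supplies all lifts at once. Each \<open>Lam_m n m\<close> and each \<open>Lam_k n k\<close>
  already involves infinitely many variables, so \<open>phi\<close> and \<open>psi\<close> are in
  fact injective on the carriers; this is why one component determines an element of the outer
  limit.

  The parameter has bounded degree because the limit is a direct sum over the degrees and not a
  product.

  Since the limit is realized as a set of finite sums, its being a graded ring has to be established
  first. This is done for arbitrary directed families because it is used at two levels: for the
  polynomial rings, and for the limits \<open>Lam_m n m\<close> and \<open>Lam_k n k\<close> inside
  the iterated limit.\<close>

context graded_ring
begin

lemma homog_closed: "x \<in> homog R r \<Longrightarrow> x \<in> carrier R"
  using subgroup.subset[OF homog_subgroup] by auto

lemma homog_zero: "\<zero> \<in> homog R r"
  using subgroup.one_closed[OF homog_subgroup] by simp

lemma homog_add: "x \<in> homog R r \<Longrightarrow> y \<in> homog R r \<Longrightarrow> x \<oplus> y \<in> homog R r"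
  using subgroup.m_closed[OF homog_subgroup] by simp

lemma homog_uminus: "x \<in> homog R r \<Longrightarrow> \<ominus> x \<in> homog R r"
  using subgroup.m_inv_closed[OF homog_subgroup] by (simp add: a_inv_def)

text \<open>Continued by zero outside \<open>B\<close>, both families become decompositions of the
  same element. The axiom \<open>homog_decomposition\<close> sums over the support of a family; this
  form frees later arguments from supports.\<close>

lemma finsum_homog_inject:
  assumes "finite B" "\<And>r. r \<in> B \<Longrightarrow> f r \<in> homog R r" "\<And>r. r \<in> B \<Longrightarrow> g r \<in> homog R r"
    and eq: "finsum R f B = finsum R g B" and "r \<in> B"
  shows "f r = g r"
proof -
  define E where "E f r = (if r \<in> B then f r else \<zero>)" for f r
  let ?D = "\<lambda>f'. (\<forall>r. f' r \<in> homog R r) \<and> finite {r. f' r \<noteq> \<zero>} \<and>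
      finsum R f B = (\<Oplus>r\<in>{r. f' r \<noteq> \<zero>}. f' r)"
  have D: "?D (E h)" if h: "\<And>r. r \<in> B \<Longrightarrow> h r \<in> homog R r" "finsum R f B = finsum R h B" for h
  proof -
    have sub: "{r. E h r \<noteq> \<zero>} \<subseteq> B" by (auto simp: E_def)
    have "finsum R (E h) {r. E h r \<noteq> \<zero>} = finsum R h B"
      by (rule add.finprod_mono_neutral_cong_left)
        (use sub assms(1) h(1) homog_closed in \<open>auto simp: E_def\<close>)
    moreover have "\<forall>r. E h r \<in> homog R r" using h(1) by (simp add: E_def homog_zero)
    ultimately show ?thesis
      using h(2) finite_subset[OF sub assms(1)] by simp
  qed
  have "finsum R f B \<in> carrier R"
    using assms(2) homog_closed by (intro finsum_closed) auto
  from homog_decomposition[OF this] D[of f] D[of g] have "E f = E g"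
    using assms(2,3) eq by blast
  then show ?thesis using \<open>r \<in> B\<close> by (metis E_def)
qed

lemma homog_decompositionE:
  assumes "x \<in> carrier R"
  obtains f B where "finite B" "\<forall>r. f r \<in> homog R r" "x = finsum R f B"
  using homog_decomposition[OF assms] that by blast

end

section \<open>Homomorphisms of graded rings\<close>

lemma ring_hom_finsum:
  assumes "ring R" "ring S" "h \<in> ring_hom R S" "finite B" "\<And>b. b \<in> B \<Longrightarrow> f b \<in> carrier R"
  shows "h (finsum R f B) = finsum S (\<lambda>b. h (f b)) B"
proof -
  interpret R: ring R by fact
  interpret S: ring S by fact
  show ?thesis using assms(4,5)
  proof (induction B rule: finite_induct)
    case empty
    show ?case using ring_hom_zero[OF assms(3,1,2)] by simp
  next
    case (insert b B)
    have "finsum R f B \<in> carrier R" using insert by (intro R.finsum_closed) auto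
    moreover have "(\<lambda>b. h (f b)) \<in> B \<rightarrow> carrier S"
      using insert ring_hom_closed[OF assms(3)] by auto
    ultimately show ?case
      using insert ring_hom_add[OF assms(3)] ring_hom_closed[OF assms(3)]
      by (simp add: Pi_def)
  qed
qed

lemma
  assumes "graded_ring_hom R S h"
  shows graded_ring_hom_source: "graded_ring R"
    and graded_ring_hom_target: "graded_ring S"
    and graded_ring_hom_ring_hom: "h \<in> ring_hom R S"
    and graded_ring_hom_homog: "x \<in> homog R r \<Longrightarrow> h x \<in> homog S r"
  using assms by (auto simp: graded_ring_hom_def)

lemma graded_ring_hom_finsum:
  assumes "graded_ring_hom R S h" "finite B" "\<And>b. b \<in> B \<Longrightarrow> f b \<in> carrier R"
  shows "h (finsum R f B) = finsum S (\<lambda>b. h (f b)) B"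
  using assms
  by (intro ring_hom_finsum graded_ring.axioms(1)[OF graded_ring_hom_source[OF assms(1)]]
      graded_ring.axioms(1)[OF graded_ring_hom_target[OF assms(1)]]
      graded_ring_hom_ring_hom[OF assms(1)])

lemma graded_ring_hom_cong:
  assumes "graded_ring_hom R S h" "\<And>x. x \<in> carrier R \<Longrightarrow> h' x = h x"
  shows "graded_ring_hom R S h'"
proof -
  interpret R: graded_ring R using assms(1) by (rule graded_ring_hom_source)
  show ?thesis
    using assms unfolding graded_ring_hom_def ring_hom_def
    by (auto simp: R.homog_closed Pi_def image_subset_iff)
qed

lemma graded_ring_hom_comp:
  assumes "graded_ring_hom R S g" "graded_ring_hom S T h"
  shows "graded_ring_hom R T (\<lambda>x. h (g x))"
  using assms ring_hom_trans[of g R S h T] unfolding graded_ring_hom_def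
  by (auto simp: o_def image_subset_iff)

text \<open>A bijective homomorphism reflects degrees, because decompositions are unique in the target.\<close>

lemma graded_ring_isoI:
  assumes h: "graded_ring_hom R S h" and bij: "bij_betw h (carrier R) (carrier S)"
  shows "graded_ring_iso R S h"
proof -
  interpret R: graded_ring R using h by (rule graded_ring_hom_source)
  interpret S: graded_ring S using h by (rule graded_ring_hom_target)
  have "homog S r \<subseteq> h ` homog R r" for r
  proof
    fix y assume y: "y \<in> homog S r"
    then obtain x where x: "x \<in> carrier R" "y = h x"
      using bij S.homog_closed by (metis bij_betw_imp_surj_on imageE)
    obtain f B where f: "finite B" "\<forall>s. f s \<in> homog R s" "x = finsum R f B"
      using R.homog_decompositionE[OF x(1)] .
    note f = f(1) f(2)[rule_format] f(3)
    define g where "g s = (if s \<in> B then f s else \<zero>\<^bsub>R\<^esub>)" for s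
    \<comment> \<open>The degree \<open>r\<close> may be missing from \<open>B\<close>. It is added
      so that the images \<open>h (g s)\<close> and the family with the single entry
      \<open>y\<close> in degree \<open>r\<close> can be compared over one index set.\<close>
    let ?B = "insert r B"
    have g: "g s \<in> homog R s" for s by (simp add: g_def f(2) R.homog_zero)
    have gc: "g s \<in> carrier R" for s using g R.homog_closed by blast
    have x_g: "x = finsum R g ?B"
      unfolding f(3)
      by (rule R.add.finprod_mono_neutral_cong_left) (use f gc R.homog_closed[OF f(2)] in \<open>auto simp: g_def\<close>)
    have hz: "h \<zero>\<^bsub>R\<^esub> = \<zero>\<^bsub>S\<^esub>"
      using ring_hom_zero[OF graded_ring_hom_ring_hom[OF h]] R.ring_axioms S.ring_axioms by blast
    have "finsum S (\<lambda>s. h (g s)) ?B = h x"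
      unfolding x_g by (rule graded_ring_hom_finsum[OF h, symmetric]) (use f gc in auto)
    also have "\<dots> = finsum S (\<lambda>s. if s = r then y else \<zero>\<^bsub>S\<^esub>) ?B"
    proof -
      have "finsum S (\<lambda>s. y) {r} = finsum S (\<lambda>s. if s = r then y else \<zero>\<^bsub>S\<^esub>) ?B"
        by (rule S.add.finprod_mono_neutral_cong_left)
          (use f y S.homog_closed in auto)
      then show ?thesis using x y S.homog_closed by simp
    qed
    finally have eq: "finsum S (\<lambda>s. h (g s)) ?B
        = finsum S (\<lambda>s. if s = r then y else \<zero>\<^bsub>S\<^esub>) ?B" .
    have "h (g s) = (if s = r then y else \<zero>\<^bsub>S\<^esub>)" if "s \<in> ?B" for s
      by (rule S.finsum_homog_inject[OF _ _ _ eq that])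
        (use f g y graded_ring_hom_homog[OF h] in \<open>auto simp: S.homog_zero\<close>)
    then have "h (g r) = y" by simp
    then show "y \<in> h ` homog R r" using g by blast
  qed
  then show ?thesis
    using assms unfolding graded_ring_iso_def graded_ring_hom_def ring_iso_def by blast
qed

section \<open>The limit of a directed family is a graded ring\<close>

locale graded_family =
  fixes I :: "'i::order set" and A :: "'i \<Rightarrow> ('a, 'm) gring_scheme" and f :: "'i \<Rightarrow> 'i \<Rightarrow> 'a \<Rightarrow> 'a"
  assumes directed: "directed_graded_family I A f"
begin

abbreviation L :: "('i \<Rightarrow> 'a) gring" where "L \<equiv> graded_lim I A f"

lemma f_hom: "i \<in> I \<Longrightarrow> j \<in> I \<Longrightarrow> i \<le> j \<Longrightarrow> graded_ring_hom (A j) (A i) (f j i)"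
  using directed by (auto simp: directed_graded_family_def)

lemma graded_ring_A: "i \<in> I \<Longrightarrow> graded_ring (A i)"
  using f_hom[of i i] by (auto simp: graded_ring_hom_def)

lemma ring_A: "i \<in> I \<Longrightarrow> ring (A i)"
  using graded_ring_A by (auto simp: graded_ring_def)

lemma L_simps:
  "monoid.mult L = (\<lambda>x y. \<lambda>i\<in>I. x i \<otimes>\<^bsub>A i\<^esub> y i)"
  "one L = (\<lambda>i\<in>I. \<one>\<^bsub>A i\<^esub>)"
  "zero L = (\<lambda>i\<in>I. \<zero>\<^bsub>A i\<^esub>)"
  "add L = (\<lambda>x y. \<lambda>i\<in>I. x i \<oplus>\<^bsub>A i\<^esub> y i)"
  by (simp_all add: graded_lim_def Let_def)

lemma homog_L: "homog L = lim_homog I A f"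
  by (simp add: graded_lim_def Let_def)

lemma lim_homog_iff:
  "x \<in> homog L r \<longleftrightarrow> x \<in> extensional I \<and> (\<forall>i\<in>I. x i \<in> homog (A i) r) \<and>
     (\<forall>i\<in>I. \<forall>j\<in>I. i \<le> j \<longrightarrow> f j i (x j) = x i)"
  by (auto simp: homog_L lim_homog_def PiE_def Pi_def)

lemma lim_homog_carrier: "x \<in> homog L r \<Longrightarrow> i \<in> I \<Longrightarrow> x i \<in> carrier (A i)"
  using graded_ring.homog_closed[OF graded_ring_A] by (auto simp: lim_homog_iff)

lemma lim_homog_zero: "\<zero>\<^bsub>L\<^esub> \<in> homog L r"
  using graded_ring.homog_zero[OF graded_ring_A]
    ring_hom_zero[OF graded_ring_hom_ring_hom[OF f_hom] ring_A ring_A]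
  by (auto simp: lim_homog_iff L_simps)

lemma lim_homog_add: "x \<in> homog L r \<Longrightarrow> y \<in> homog L r \<Longrightarrow> x \<oplus>\<^bsub>L\<^esub> y \<in> homog L r"
  using graded_ring.homog_add[OF graded_ring_A] lim_homog_carrier
    ring_hom_add[OF graded_ring_hom_ring_hom[OF f_hom]]
  by (auto simp: lim_homog_iff L_simps)

text \<open>Negation is written componentwise because \<open>\<ominus>\<close> of the limit can be
  evaluated only once the limit is known to be a group. The same applies to
  \<open>lim_uminus_closed\<close>.\<close>

lemma lim_homog_uminus:
  assumes "x \<in> homog L r"
  shows "(\<lambda>i\<in>I. \<ominus>\<^bsub>A i\<^esub> x i) \<in> homog L r"
proof -
  have "f j i (\<ominus>\<^bsub>A j\<^esub> x j) = \<ominus>\<^bsub>A i\<^esub> x i" if "i \<in> I" "j \<in> I" "i \<le> j" for i j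
  proof -
    interpret ring_hom_ring "A j" "A i" "f j i"
      using that by (intro ring_hom_ringI2 ring_A graded_ring_hom_ring_hom[OF f_hom])
    show ?thesis using assms that lim_homog_carrier[OF assms] by (auto simp: lim_homog_iff)
  qed
  then show ?thesis
    using assms graded_ring.homog_uminus[OF graded_ring_A] by (auto simp: lim_homog_iff)
qed

lemma lim_homog_mult:
  "x \<in> homog L r \<Longrightarrow> y \<in> homog L s \<Longrightarrow> x \<otimes>\<^bsub>L\<^esub> y \<in> homog L (r + s)"
  using graded_ring.mult_homog[OF graded_ring_A] lim_homog_carrier
    ring_hom_mult[OF graded_ring_hom_ring_hom[OF f_hom]]
  by (auto simp: lim_homog_iff L_simps)

lemma lim_one_homog: "\<one>\<^bsub>L\<^esub> \<in> homog L 0"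
  using graded_ring.one_homog[OF graded_ring_A]
    ring_hom_one[OF graded_ring_hom_ring_hom[OF f_hom]]
  by (auto simp: lim_homog_iff L_simps)

text \<open>The carrier is defined by sums over the support of a family, which differs from element
  to element. Zero terms make the sum independent of the index set, so that two elements can share
  one.\<close>

lemma lim_finsum_superset:
  assumes "finite B" "\<And>r. g r \<in> homog L r" "\<And>r. r \<notin> C \<Longrightarrow> g r = \<zero>\<^bsub>L\<^esub>" "C \<subseteq> B"
  shows "(\<lambda>i\<in>I. \<Oplus>\<^bsub>A i\<^esub>r\<in>C. g r i) = (\<lambda>i\<in>I. \<Oplus>\<^bsub>A i\<^esub>r\<in>B. g r i)"
proof (rule restrict_ext)
  fix i assume i: "i \<in> I"
  interpret ring "A i" using i by (rule ring_A)
  show "(\<Oplus>\<^bsub>A i\<^esub>r\<in>C. g r i) = (\<Oplus>\<^bsub>A i\<^esub>r\<in>B. g r i)"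
    by (rule add.finprod_mono_neutral_cong_left)
      (use assms i lim_homog_carrier[OF assms(2) i] in \<open>auto simp: L_simps\<close>)
qed

text \<open>The definition of the carrier asks for a homogeneous family in every degree, summed over
  its own support. Cutting \<open>g\<close> off to zero outside \<open>B\<close> produces such a
  family.\<close>

lemma lim_carrierI:
  assumes "finite B" "\<And>r. r \<in> B \<Longrightarrow> g r \<in> homog L r" "x = (\<lambda>i\<in>I. \<Oplus>\<^bsub>A i\<^esub>r\<in>B. g r i)"
  shows "x \<in> carrier L"
proof -
  define g' where "g' r = (if r \<in> B then g r else \<zero>\<^bsub>L\<^esub>)" for r
  have g': "g' r \<in> homog L r" for r using assms(2) by (simp add: g'_def lim_homog_zero)
  have sub: "{r. g' r \<noteq> \<zero>\<^bsub>L\<^esub>} \<subseteq> B" by (auto simp: g'_def)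
  have "x = (\<lambda>i\<in>I. \<Oplus>\<^bsub>A i\<^esub>r\<in>B. g' r i)"
    unfolding assms(3)
  proof (rule restrict_ext)
    fix i assume i: "i \<in> I"
    interpret ring "A i" using i by (rule ring_A)
    show "(\<Oplus>\<^bsub>A i\<^esub>r\<in>B. g r i) = (\<Oplus>\<^bsub>A i\<^esub>r\<in>B. g' r i)"
      by (rule finsum_cong') (use lim_homog_carrier[OF g' i] in \<open>auto simp: g'_def\<close>)
  qed
  also have "\<dots> = (\<lambda>i\<in>I. \<Oplus>\<^bsub>A i\<^esub>r\<in>{r. g' r \<noteq> \<zero>\<^bsub>L\<^esub>}. g' r i)"
    by (rule lim_finsum_superset[symmetric]) (use assms(1) g' sub in auto)
  finally have x: "x = (\<lambda>i\<in>I. \<Oplus>\<^bsub>A i\<^esub>r\<in>{r. g' r \<noteq> \<zero>\<^bsub>L\<^esub>}. g' r i)" .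
  have "finite {r. g' r \<noteq> \<zero>\<^bsub>L\<^esub>}" using sub assms(1) by (rule finite_subset)
  with x show ?thesis using g' unfolding homog_L unfolding L_simps graded_lim_def Let_def by auto
qed

text \<open>The quantified \<open>C\<close> allows two elements to be expanded over the same index
  set, as \<open>lim_add_closed\<close> does with \<open>B \<union> B'\<close>.\<close>

lemma lim_carrierE:
  assumes "x \<in> carrier L"
  obtains B g where "finite B" "\<forall>r. g r \<in> homog L r"
    "\<forall>C. finite C \<longrightarrow> B \<subseteq> C \<longrightarrow> x = (\<lambda>i\<in>I. \<Oplus>\<^bsub>A i\<^esub>r\<in>C. g r i)"
proof -
  obtain g where g: "\<And>r. g r \<in> homog L r" "finite {r. g r \<noteq> \<zero>\<^bsub>L\<^esub>}"
      "x = (\<lambda>i\<in>I. \<Oplus>\<^bsub>A i\<^esub>r\<in>{r. g r \<noteq> \<zero>\<^bsub>L\<^esub>}. g r i)"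
    using assms unfolding homog_L unfolding L_simps graded_lim_def Let_def by auto
  show thesis
  proof (rule that[OF g(2)]; intro allI impI)
    show "g r \<in> homog L r" for r by (rule g(1))
  next
    fix C assume C: "finite C" "{r. g r \<noteq> \<zero>\<^bsub>L\<^esub>} \<subseteq> C"
    show "x = (\<lambda>i\<in>I. \<Oplus>\<^bsub>A i\<^esub>r\<in>C. g r i)"
      unfolding g(3) by (rule lim_finsum_superset) (use C g in auto)
  qed
qed

lemma homog_in_lim_carrier:
  assumes "x \<in> homog L r" shows "x \<in> carrier L"
proof (rule lim_carrierI[of "{r}" "\<lambda>_. x"])
  have "(\<lambda>i\<in>I. \<Oplus>\<^bsub>A i\<^esub>r\<in>{r}. x i) = (\<lambda>i\<in>I. x i)"
  proof (rule restrict_ext)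
    fix i assume i: "i \<in> I"
    interpret ring "A i" using i by (rule ring_A)
    show "(\<Oplus>\<^bsub>A i\<^esub>r\<in>{r}. x i) = x i" using lim_homog_carrier[OF assms i] by simp
  qed
  then show "x = (\<lambda>i\<in>I. \<Oplus>\<^bsub>A i\<^esub>r\<in>{r}. x i)"
    using assms by (simp add: extensional_restrict lim_homog_iff)
qed (use assms in auto)

lemma lim_carrier_ext: "x \<in> carrier L \<Longrightarrow> x \<in> extensional I"
  by (elim lim_carrierE) auto

lemma lim_carrier_component:
  assumes "x \<in> carrier L" "i \<in> I" shows "x i \<in> carrier (A i)"
proof -
  obtain B g where g: "finite B" "\<forall>r. g r \<in> homog L r"
    "\<forall>C. finite C \<longrightarrow> B \<subseteq> C \<longrightarrow> x = (\<lambda>i\<in>I. \<Oplus>\<^bsub>A i\<^esub>r\<in>C. g r i)"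
    using lim_carrierE[OF assms(1)] .
  note g = g(1) g(2)[rule_format] g(3)[rule_format]
  interpret ring "A i" using assms(2) by (rule ring_A)
  have "x i = (\<Oplus>\<^bsub>A i\<^esub>r\<in>B. g r i)" using fun_cong[OF g(3)[OF g(1)], of i] assms(2) by simp
  then show ?thesis using lim_homog_carrier[OF g(2) assms(2)] by (simp add: finsum_closed)
qed

lemma lim_add_closed:
  assumes "x \<in> carrier L" "y \<in> carrier L" shows "x \<oplus>\<^bsub>L\<^esub> y \<in> carrier L"
proof -
  obtain B g where g: "finite B" "\<forall>r. g r \<in> homog L r"
    "\<forall>C. finite C \<longrightarrow> B \<subseteq> C \<longrightarrow> x = (\<lambda>i\<in>I. \<Oplus>\<^bsub>A i\<^esub>r\<in>C. g r i)"
    using lim_carrierE[OF assms(1)] .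
  note g = g(1) g(2)[rule_format] g(3)[rule_format]
  obtain B' g' where g': "finite B'" "\<forall>r. g' r \<in> homog L r"
    "\<forall>C. finite C \<longrightarrow> B' \<subseteq> C \<longrightarrow> y = (\<lambda>i\<in>I. \<Oplus>\<^bsub>A i\<^esub>r\<in>C. g' r i)"
    using lim_carrierE[OF assms(2)] .
  note g' = g'(1) g'(2)[rule_format] g'(3)[rule_format]
  show ?thesis
  proof (rule lim_carrierI[of "B \<union> B'" "\<lambda>r. g r \<oplus>\<^bsub>L\<^esub> g' r"])
    have x: "x = (\<lambda>i\<in>I. \<Oplus>\<^bsub>A i\<^esub>r\<in>B \<union> B'. g r i)" by (rule g(3)) (use g g' in auto)
    have y: "y = (\<lambda>i\<in>I. \<Oplus>\<^bsub>A i\<^esub>r\<in>B \<union> B'. g' r i)" by (rule g'(3)) (use g g' in auto)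
    show "x \<oplus>\<^bsub>L\<^esub> y = (\<lambda>i\<in>I. \<Oplus>\<^bsub>A i\<^esub>r\<in>B \<union> B'. (g r \<oplus>\<^bsub>L\<^esub> g' r) i)"
      unfolding L_simps
    proof (rule restrict_ext)
      fix i assume i: "i \<in> I"
      interpret ring "A i" using i by (rule ring_A)
      show "x i \<oplus>\<^bsub>A i\<^esub> y i = (\<Oplus>\<^bsub>A i\<^esub>r\<in>B \<union> B'. (\<lambda>i\<in>I. g r i \<oplus>\<^bsub>A i\<^esub> g' r i) i)"
        using i lim_homog_carrier[OF g(2) i] lim_homog_carrier[OF g'(2) i]
        by (simp add: x y finsum_addf)
    qed
  qed (use g g' lim_homog_add in auto)
qed

lemma lim_uminus_closed:
  assumes "x \<in> carrier L" shows "(\<lambda>i\<in>I. \<ominus>\<^bsub>A i\<^esub> x i) \<in> carrier L"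
proof -
  obtain B g where g: "finite B" "\<forall>r. g r \<in> homog L r"
    "\<forall>C. finite C \<longrightarrow> B \<subseteq> C \<longrightarrow> x = (\<lambda>i\<in>I. \<Oplus>\<^bsub>A i\<^esub>r\<in>C. g r i)"
    using lim_carrierE[OF assms(1)] .
  note g = g(1) g(2)[rule_format] g(3)[rule_format]
  show ?thesis
  proof (rule lim_carrierI[of B "\<lambda>r. \<lambda>i\<in>I. \<ominus>\<^bsub>A i\<^esub> g r i"])
    show "(\<lambda>i\<in>I. \<ominus>\<^bsub>A i\<^esub> x i) = (\<lambda>i\<in>I. \<Oplus>\<^bsub>A i\<^esub>r\<in>B. (\<lambda>i\<in>I. \<ominus>\<^bsub>A i\<^esub> g r i) i)"
    proof (rule restrict_ext)
      fix i assume i: "i \<in> I"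
      interpret ring "A i" using i by (rule ring_A)
      have gc: "g r i \<in> carrier (A i)" for r using lim_homog_carrier[OF g(2) i] .
      have "x i = (\<Oplus>\<^bsub>A i\<^esub>r\<in>B. g r i)" using fun_cong[OF g(3)[OF g(1)], of i] i by simp
      moreover have "(\<Oplus>\<^bsub>A i\<^esub>r\<in>B. \<ominus>\<^bsub>A i\<^esub> g r i) \<oplus>\<^bsub>A i\<^esub> (\<Oplus>\<^bsub>A i\<^esub>r\<in>B. g r i) = \<zero>\<^bsub>A i\<^esub>"
        using gc by (simp add: l_neg flip: finsum_addf)
      ultimately show "\<ominus>\<^bsub>A i\<^esub> x i = (\<Oplus>\<^bsub>A i\<^esub>r\<in>B. (\<lambda>i\<in>I. \<ominus>\<^bsub>A i\<^esub> g r i) i)"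
        using i gc by (intro minus_equality) simp_all
    qed
  qed (use g lim_homog_uminus in auto)
qed

text \<open>Elements of the limit are built up from zero by adding homogeneous ones. Compatibility,
  closure under products and the degree bound of symmetric families pass through single additions,
  which avoids double sums.\<close>

lemma lim_carrier_induct [consumes 1, case_names zero add]:
  assumes "x \<in> carrier L"
    and zero: "Q \<zero>\<^bsub>L\<^esub>"
    and add: "\<And>r h y. h \<in> homog L r \<Longrightarrow> y \<in> carrier L \<Longrightarrow> Q y \<Longrightarrow> Q (h \<oplus>\<^bsub>L\<^esub> y)"
  shows "Q x"
proof -
  obtain B g where g: "finite B" "\<forall>r. g r \<in> homog L r"
    "\<forall>C. finite C \<longrightarrow> B \<subseteq> C \<longrightarrow> x = (\<lambda>i\<in>I. \<Oplus>\<^bsub>A i\<^esub>r\<in>C. g r i)"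
    using lim_carrierE[OF assms(1)] .
  note g = g(1) g(2)[rule_format] g(3)[rule_format]
  have "Q (\<lambda>i\<in>I. \<Oplus>\<^bsub>A i\<^esub>r\<in>B. g r i)"
    using g(1)
  proof (induction B rule: finite_induct)
    case empty
    have "(\<lambda>i\<in>I. \<Oplus>\<^bsub>A i\<^esub>r\<in>{}. g r i) = \<zero>\<^bsub>L\<^esub>"
      unfolding L_simps
      by (rule restrict_ext) (simp add: abelian_monoid.finsum_empty[OF ring.is_abelian_group[OF ring_A, THEN abelian_group.axioms(1)]])
    then show ?case using zero by simp
  next
    case (insert b B)
    have "(\<lambda>i\<in>I. \<Oplus>\<^bsub>A i\<^esub>r\<in>insert b B. g r i) = g b \<oplus>\<^bsub>L\<^esub> (\<lambda>i\<in>I. \<Oplus>\<^bsub>A i\<^esub>r\<in>B. g r i)"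
      unfolding L_simps
    proof (rule restrict_ext)
      fix i assume i: "i \<in> I"
      interpret ring "A i" using i by (rule ring_A)
      show "(\<Oplus>\<^bsub>A i\<^esub>r\<in>insert b B. g r i)
          = g b i \<oplus>\<^bsub>A i\<^esub> (\<lambda>i\<in>I. \<Oplus>\<^bsub>A i\<^esub>r\<in>B. g r i) i"
        using i insert lim_homog_carrier[OF g(2) i] by simp
    qed
    moreover have "(\<lambda>i\<in>I. \<Oplus>\<^bsub>A i\<^esub>r\<in>B. g r i) \<in> carrier L"
      by (rule lim_carrierI[of B g]) (use insert g in auto)
    ultimately show ?case using add[OF g(2) _ insert.IH] by (simp only:)
  qed
  then show ?thesis using g by simp
qed

lemma lim_carrier_compatible:
  assumes "x \<in> carrier L" "i \<in> I" "j \<in> I" "i \<le> j"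
  shows "f j i (x j) = x i"
  using assms(1)
proof (induction rule: lim_carrier_induct)
  case zero
  show ?case using lim_homog_zero assms by (auto simp: lim_homog_iff)
next
  case (add r h y)
  then show ?case
    using assms(2-) lim_homog_carrier lim_carrier_component
      ring_hom_add[OF graded_ring_hom_ring_hom[OF f_hom[OF assms(2-)]], of "h j" "y j"]
    by (auto simp: L_simps(4) lim_homog_iff)
qed

lemma lim_mult_closed:
  assumes "x \<in> carrier L" "y \<in> carrier L" shows "x \<otimes>\<^bsub>L\<^esub> y \<in> carrier L"
  using assms(1)
proof (induction rule: lim_carrier_induct)
  case zero
  have "\<zero>\<^bsub>L\<^esub> \<otimes>\<^bsub>L\<^esub> y = \<zero>\<^bsub>L\<^esub>"
    unfolding L_simps
    by (rule restrict_ext) (simp add: ring.ring_simprules[OF ring_A] lim_carrier_component assms)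
  then show ?case using homog_in_lim_carrier[OF lim_homog_zero] by simp
next
  case (add r h x)
  \<comment> \<open>A second induction, now on the right factor, reduces the claim to products of
    two homogeneous elements.\<close>
  have "h \<otimes>\<^bsub>L\<^esub> y \<in> carrier L"
    using assms(2)
  proof (induction rule: lim_carrier_induct)
    case zero
    have "h \<otimes>\<^bsub>L\<^esub> \<zero>\<^bsub>L\<^esub> = \<zero>\<^bsub>L\<^esub>"
      unfolding L_simps
      by (rule restrict_ext) (simp add: ring.ring_simprules[OF ring_A] lim_homog_carrier[OF add(1)])
    then show ?case using homog_in_lim_carrier[OF lim_homog_zero] by simp
  next
    case (add s k y)
    \<comment> \<open>Distributivity comes from the components, since the limit is not yet known to
      be a ring.\<close>
    have "h \<otimes>\<^bsub>L\<^esub> (k \<oplus>\<^bsub>L\<^esub> y) = h \<otimes>\<^bsub>L\<^esub> k \<oplus>\<^bsub>L\<^esub> h \<otimes>\<^bsub>L\<^esub> y"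
      unfolding L_simps
      by (rule restrict_ext)
        (simp add: ring.ring_simprules[OF ring_A] lim_homog_carrier[OF add(1)]
          lim_homog_carrier[OF \<open>h \<in> _\<close>] lim_carrier_component[OF add(2)])
    then show ?case
      using add homog_in_lim_carrier[OF lim_homog_mult[OF \<open>h \<in> _\<close> add(1)]] lim_add_closed by simp
  qed
  moreover have "(h \<oplus>\<^bsub>L\<^esub> x) \<otimes>\<^bsub>L\<^esub> y = h \<otimes>\<^bsub>L\<^esub> y \<oplus>\<^bsub>L\<^esub> x \<otimes>\<^bsub>L\<^esub> y"
    unfolding L_simps
    by (rule restrict_ext)
      (simp add: ring.ring_simprules[OF ring_A] lim_homog_carrier[OF add(1)]
        lim_carrier_component[OF add(2)] lim_carrier_component[OF assms(2)])
  ultimately show ?case using add lim_add_closed by simp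
qed

lemma ring_L: "ring L"
proof (rule ringI)
  note comp = lim_carrier_component and simps = ring.ring_simprules[OF ring_A]
  show "abelian_group L"
  proof (rule abelian_groupI)
    fix x y z assume "x \<in> carrier L" "y \<in> carrier L" "z \<in> carrier L"
    then show "x \<oplus>\<^bsub>L\<^esub> y \<oplus>\<^bsub>L\<^esub> z = x \<oplus>\<^bsub>L\<^esub> (y \<oplus>\<^bsub>L\<^esub> z)"
      unfolding L_simps by (intro restrict_ext) (simp add: comp simps)
  next
    fix x y assume "x \<in> carrier L" "y \<in> carrier L"
    then show "x \<oplus>\<^bsub>L\<^esub> y = y \<oplus>\<^bsub>L\<^esub> x"
      unfolding L_simps by (intro restrict_ext) (simp add: comp simps)
  next
    fix x assume x: "x \<in> carrier L"
    \<comment> \<open>Sums in the limit are restricted to \<open>I\<close>, so the result is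
      \<open>x\<close> itself only because elements of the limit are extensional.\<close>
    have "\<zero>\<^bsub>L\<^esub> \<oplus>\<^bsub>L\<^esub> x = restrict x I"
      unfolding L_simps by (intro restrict_ext) (simp add: comp x simps)
    then show "\<zero>\<^bsub>L\<^esub> \<oplus>\<^bsub>L\<^esub> x = x" using lim_carrier_ext[OF x] by (simp add: extensional_restrict)
    have "(\<lambda>i\<in>I. \<ominus>\<^bsub>A i\<^esub> x i) \<oplus>\<^bsub>L\<^esub> x = \<zero>\<^bsub>L\<^esub>"
      unfolding L_simps by (intro restrict_ext) (simp add: comp x simps)
    then show "\<exists>y\<in>carrier L. y \<oplus>\<^bsub>L\<^esub> x = \<zero>\<^bsub>L\<^esub>" using lim_uminus_closed[OF x] by blast
  qed (auto simp: lim_add_closed homog_in_lim_carrier[OF lim_homog_zero])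
  show "monoid L"
  proof (rule monoidI)
    fix x y z assume "x \<in> carrier L" "y \<in> carrier L" "z \<in> carrier L"
    then show "x \<otimes>\<^bsub>L\<^esub> y \<otimes>\<^bsub>L\<^esub> z = x \<otimes>\<^bsub>L\<^esub> (y \<otimes>\<^bsub>L\<^esub> z)"
      unfolding L_simps by (intro restrict_ext) (simp add: comp simps)
  next
    fix x assume x: "x \<in> carrier L"
    have "\<one>\<^bsub>L\<^esub> \<otimes>\<^bsub>L\<^esub> x = restrict x I" "x \<otimes>\<^bsub>L\<^esub> \<one>\<^bsub>L\<^esub> = restrict x I"
      unfolding L_simps
      by (intro restrict_ext;
          simp add: comp x monoid.l_one[OF ring.is_monoid[OF ring_A]]
            monoid.r_one[OF ring.is_monoid[OF ring_A]])+
    then show "\<one>\<^bsub>L\<^esub> \<otimes>\<^bsub>L\<^esub> x = x" "x \<otimes>\<^bsub>L\<^esub> \<one>\<^bsub>L\<^esub> = x"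
      using lim_carrier_ext[OF x] by (simp_all add: extensional_restrict)
  qed (auto simp: lim_mult_closed homog_in_lim_carrier[OF lim_one_homog])
  fix x y z assume "x \<in> carrier L" "y \<in> carrier L" "z \<in> carrier L"
  then show "(x \<oplus>\<^bsub>L\<^esub> y) \<otimes>\<^bsub>L\<^esub> z = x \<otimes>\<^bsub>L\<^esub> z \<oplus>\<^bsub>L\<^esub> y \<otimes>\<^bsub>L\<^esub> z"
    "z \<otimes>\<^bsub>L\<^esub> (x \<oplus>\<^bsub>L\<^esub> y) = z \<otimes>\<^bsub>L\<^esub> x \<oplus>\<^bsub>L\<^esub> z \<otimes>\<^bsub>L\<^esub> y"
    unfolding L_simps by (intro restrict_ext; simp add: comp simps)+
qed

lemma finsum_L:
  assumes "finite B" "\<And>b. b \<in> B \<Longrightarrow> g b \<in> carrier L"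
  shows "finsum L g B = (\<lambda>i\<in>I. \<Oplus>\<^bsub>A i\<^esub>b\<in>B. g b i)"
proof -
  interpret L: ring L by (rule ring_L)
  have ext: "finsum L g B \<in> extensional I"
    using assms by (intro lim_carrier_ext L.finsum_closed) auto
  have "finsum L g B i = (\<Oplus>\<^bsub>A i\<^esub>b\<in>B. g b i)" if i: "i \<in> I" for i
    using assms
  proof (induction B rule: finite_induct)
    case empty
    interpret ring "A i" using i by (rule ring_A)
    show ?case using i by (simp add: L_simps)
  next
    case (insert b B)
    interpret ring "A i" using i by (rule ring_A)
    have "finsum L g (insert b B) = g b \<oplus>\<^bsub>L\<^esub> finsum L g B"
      using insert by (intro L.finsum_insert) auto
    then have "finsum L g (insert b B) i = g b i \<oplus>\<^bsub>A i\<^esub> finsum L g B i"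
      using i by (simp add: L_simps)
    then show ?case using insert i lim_carrier_component by (simp add: Pi_def)
  qed
  then show ?thesis using ext by (intro extensionalityI[of _ I]) auto
qed

text \<open>Existence of decompositions is built into the carrier. Uniqueness is inherited: at each
  index \<open>i\<close>, two decompositions of \<open>x\<close> are decompositions of
  \<open>x i\<close> in the graded ring \<open>A i\<close>, taken over the union of both
  supports.\<close>

lemma graded_ring_L: "graded_ring L"
proof -
  interpret L: ring L by (rule ring_L)
  show ?thesis
  proof (intro graded_ring.intro graded_ring_axioms.intro ring_L)
    fix r
    show "subgroup (homog L r) (add_monoid L)"
    proof (rule L.add.subgroupI)
      show "homog L r \<noteq> {}" using lim_homog_zero by blast
    next
      fix x assume x: "x \<in> homog L r"
      have "(\<lambda>i\<in>I. \<ominus>\<^bsub>A i\<^esub> x i) \<oplus>\<^bsub>L\<^esub> x = \<zero>\<^bsub>L\<^esub>"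
        unfolding L_simps
        by (intro restrict_ext) (simp add: lim_homog_carrier[OF x] ring.ring_simprules[OF ring_A])
      then have "\<ominus>\<^bsub>L\<^esub> x = (\<lambda>i\<in>I. \<ominus>\<^bsub>A i\<^esub> x i)"
        using x by (intro L.minus_equality homog_in_lim_carrier lim_homog_uminus)
      then show "\<ominus>\<^bsub>L\<^esub> x \<in> homog L r" using lim_homog_uminus[OF x] by simp
    qed (use homog_in_lim_carrier lim_homog_add in auto)
  next
    fix x assume x: "x \<in> carrier L"
    let ?D = "\<lambda>g. (\<forall>r. g r \<in> homog L r) \<and> finite {r. g r \<noteq> \<zero>\<^bsub>L\<^esub>} \<and>
        x = finsum L g {r. g r \<noteq> \<zero>\<^bsub>L\<^esub>}"
    have D: "x i = (\<Oplus>\<^bsub>A i\<^esub>r\<in>B. g r i)"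
      if "?D g" "finite B" "{r. g r \<noteq> \<zero>\<^bsub>L\<^esub>} \<subseteq> B" "i \<in> I" for g B i
    proof -
      have "x = finsum L g {r. g r \<noteq> \<zero>\<^bsub>L\<^esub>}" using that(1) by (elim conjE)
      also have "\<dots> = (\<lambda>i\<in>I. \<Oplus>\<^bsub>A i\<^esub>r\<in>{r. g r \<noteq> \<zero>\<^bsub>L\<^esub>}. g r i)"
        by (rule finsum_L) (use that(1) homog_in_lim_carrier in blast)+
      also have "\<dots> = (\<lambda>i\<in>I. \<Oplus>\<^bsub>A i\<^esub>r\<in>B. g r i)"
        by (rule lim_finsum_superset) (use that in auto)
      finally have "x = (\<lambda>i\<in>I. \<Oplus>\<^bsub>A i\<^esub>r\<in>B. g r i)" .
      from fun_cong[OF this, of i] show ?thesis using that(4) by (simp only: restrict_apply')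
    qed
    show "\<exists>!g. ?D g"
    proof (rule ex_ex1I)
      obtain g where g: "\<And>r. g r \<in> homog L r" "finite {r. g r \<noteq> \<zero>\<^bsub>L\<^esub>}"
        "x = (\<lambda>i\<in>I. \<Oplus>\<^bsub>A i\<^esub>r\<in>{r. g r \<noteq> \<zero>\<^bsub>L\<^esub>}. g r i)"
        using x unfolding homog_L unfolding L_simps graded_lim_def Let_def by auto
      moreover have "finsum L g {r. g r \<noteq> \<zero>\<^bsub>L\<^esub>}
          = (\<lambda>i\<in>I. \<Oplus>\<^bsub>A i\<^esub>r\<in>{r. g r \<noteq> \<zero>\<^bsub>L\<^esub>}. g r i)"
        by (rule finsum_L[OF g(2) homog_in_lim_carrier[OF g(1)]])
      ultimately have "?D g" by (simp only: simp_thms)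
      then show "\<exists>g. ?D g" by (rule exI[where x = g])
    next
      fix g g' assume g: "?D g" and g': "?D g'"
      let ?B = "{r. g r \<noteq> \<zero>\<^bsub>L\<^esub>} \<union> {r. g' r \<noteq> \<zero>\<^bsub>L\<^esub>}"
      have "g r i = g' r i" if r: "r \<in> ?B" and i: "i \<in> I" for r i
      proof (rule graded_ring.finsum_homog_inject[OF graded_ring_A[OF i] _ _ _ _ r])
        show "(\<Oplus>\<^bsub>A i\<^esub>r\<in>?B. g r i) = (\<Oplus>\<^bsub>A i\<^esub>r\<in>?B. g' r i)"
          using D[OF g _ _ i, of ?B] D[OF g' _ _ i, of ?B] g g' by (simp only: finite_Un Un_upper1 Un_upper2)
      qed (use g g' i lim_homog_iff in auto)
      then have "g r = g' r" if "r \<in> ?B" for r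
        using that g g' lim_homog_iff by (intro extensionalityI[of _ I]) blast+
      then show "g = g'" by (intro ext) (metis (mono_tags, lifting) UnI1 UnI2 mem_Collect_eq)
    qed
  qed (use lim_one_homog lim_homog_mult in auto)
qed

lemma graded_ring_hom_component:
  assumes "i \<in> I" shows "graded_ring_hom L (A i) (\<lambda>x. x i)"
  unfolding graded_ring_hom_def ring_hom_def
  using assms graded_ring_L graded_ring_A lim_carrier_component
  by (auto simp: lim_homog_iff) (auto simp: L_simps)

text \<open>This is the existence half of the universal property of the limit. The grading of
  \<open>R\<close> puts the image into the carrier: the finitely many homogeneous parts of
  \<open>x\<close> give the finite sum of compatible homogeneous families that membership
  requires.\<close>

lemma graded_ring_hom_limI:
  assumes R: "graded_ring R" and h: "\<And>i. i \<in> I \<Longrightarrow> graded_ring_hom R (A i) (h i)"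
    and compat: "\<And>i j x. i \<in> I \<Longrightarrow> j \<in> I \<Longrightarrow> i \<le> j \<Longrightarrow> x \<in> carrier R \<Longrightarrow> f j i (h j x) = h i x"
  shows "graded_ring_hom R L (\<lambda>x. \<lambda>i\<in>I. h i x)"
proof -
  interpret R: graded_ring R by fact
  have homog: "(\<lambda>i\<in>I. h i x) \<in> homog L r" if "x \<in> homog R r" for x r
    using that graded_ring_hom_homog[OF h] compat R.homog_closed
    by (auto simp: lim_homog_iff)
  moreover have "(\<lambda>i\<in>I. h i x) \<in> carrier L" if "x \<in> carrier R" for x
  proof -
    obtain g B where g: "finite B" "\<forall>r. g r \<in> homog R r" "x = finsum R g B"
      using R.homog_decompositionE[OF \<open>x \<in> carrier R\<close>] .
    note g = g(1) g(2)[rule_format] g(3)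
    show ?thesis
    proof (rule lim_carrierI[of B "\<lambda>r. \<lambda>i\<in>I. h i (g r)"])
      show "(\<lambda>i\<in>I. h i x) = (\<lambda>i\<in>I. \<Oplus>\<^bsub>A i\<^esub>r\<in>B. (\<lambda>i\<in>I. h i (g r)) i)"
        by (intro restrict_ext)
          (use g(1) R.homog_closed[OF g(2)] in
            \<open>simp add: g(3) graded_ring_hom_finsum[OF h, OF _ g(1)] cong: restrict_cong\<close>)
    qed (use g homog in auto)
  qed
  ultimately show ?thesis
    unfolding graded_ring_hom_def ring_hom_def
    using R graded_ring_L ring_hom_add[OF graded_ring_hom_ring_hom[OF h]]
      ring_hom_mult[OF graded_ring_hom_ring_hom[OF h]]
      ring_hom_one[OF graded_ring_hom_ring_hom[OF h]]
    by (auto simp: L_simps intro!: restrict_ext)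
qed

end

section \<open>Substitution in polynomials\<close>

text \<open>For claims additive in \<open>P\<close> it does not matter whether \<open>t\<close>
  already occurs in \<open>P\<close>, so the side condition of \<open>update_induct\<close>
  disappears.\<close>

lemma poly_mapping_add_induct [case_names zero add]:
  assumes "Q 0"
    and "\<And>P t c. Q P \<Longrightarrow> Q (Poly_Mapping.single t c + P)"
  shows "Q (P :: 'a \<Rightarrow>\<^sub>0 'b::ab_group_add)"
proof (induction P rule: Poly_Mapping.update_induct)
  case const
  show ?case by (rule assms(1))
next
  case (update f a b)
  have "Poly_Mapping.update a b f = Poly_Mapping.single a b + f"
    using update(1)
    by (intro poly_mapping_eqI)
      (auto simp: lookup_update lookup_add lookup_single when_def in_keys_iff)
  then show ?case using assms(2)[OF update(3)] by simp
qed

text \<open>The image of a single monomial under \<open>psubst\<close>, split off because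
  multiplicativity of \<open>psubst\<close> reduces to monomials.\<close>

definition msubst :: "('x \<Rightarrow> 'y zpoly) \<Rightarrow> ('x \<Rightarrow>\<^sub>0 nat) \<Rightarrow> 'y zpoly" where
  "msubst \<sigma> t = (\<Prod>x\<in>Poly_Mapping.keys t. \<sigma> x ^ Poly_Mapping.lookup t x)"

lemma msubst_superset:
  "finite A \<Longrightarrow> Poly_Mapping.keys t \<subseteq> A \<Longrightarrow> msubst \<sigma> t = (\<Prod>x\<in>A. \<sigma> x ^ Poly_Mapping.lookup t x)"
  unfolding msubst_def by (intro prod.mono_neutral_left) (auto simp: in_keys_iff)

lemma msubst_0: "msubst \<sigma> 0 = 1"
  by (simp add: msubst_def)

lemma msubst_add: "msubst \<sigma> (s + t) = msubst \<sigma> s * msubst \<sigma> t"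
proof -
  let ?A = "Poly_Mapping.keys s \<union> Poly_Mapping.keys t"
  have "msubst \<sigma> (s + t) = (\<Prod>x\<in>?A. \<sigma> x ^ Poly_Mapping.lookup (s + t) x)"
    by (intro msubst_superset) (auto simp: keys_add)
  also have "\<dots> = msubst \<sigma> s * msubst \<sigma> t"
    by (simp add: msubst_superset[of ?A] lookup_add power_add prod.distrib)
  finally show ?thesis .
qed

lemma psubst_superset:
  "finite A \<Longrightarrow> Poly_Mapping.keys P \<subseteq> A \<Longrightarrow>
    psubst \<sigma> P = (\<Sum>t\<in>A. of_int (Poly_Mapping.lookup P t) * msubst \<sigma> t)"
  unfolding psubst_def msubst_def by (intro sum.mono_neutral_left) (auto simp: in_keys_iff)

lemma psubst_0 [simp]: "psubst \<sigma> 0 = 0"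
  by (simp add: psubst_def)

lemma psubst_add: "psubst \<sigma> (P + Q) = psubst \<sigma> P + psubst \<sigma> Q"
proof -
  let ?A = "Poly_Mapping.keys P \<union> Poly_Mapping.keys Q"
  have "psubst \<sigma> (P + Q) = (\<Sum>t\<in>?A. of_int (Poly_Mapping.lookup (P + Q) t) * msubst \<sigma> t)"
    by (intro psubst_superset) (auto simp: keys_add)
  also have "\<dots> = psubst \<sigma> P + psubst \<sigma> Q"
    by (simp add: psubst_superset[of ?A] lookup_add distrib_right sum.distrib)
  finally show ?thesis .
qed

lemma psubst_uminus: "psubst \<sigma> (- P) = - psubst \<sigma> P"
  using psubst_add[of \<sigma> P "- P"] by (simp add: eq_neg_iff_add_eq_0 add.commute)

lemma psubst_single: "psubst \<sigma> (Poly_Mapping.single t c) = of_int c * msubst \<sigma> t"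
  by (subst psubst_superset[of "{t}"]) (auto simp: keys_single)

lemma psubst_1 [simp]: "psubst \<sigma> 1 = 1"
  using psubst_single[of \<sigma> 0 1] by (simp add: msubst_0)

lemma psubst_mult: "psubst \<sigma> (P * Q) = psubst \<sigma> P * psubst \<sigma> Q"
proof (induction P rule: poly_mapping_add_induct)
  case zero
  show ?case by simp
next
  case (add P s c)
  have "psubst \<sigma> (Poly_Mapping.single s c * Q) = psubst \<sigma> (Poly_Mapping.single s c) * psubst \<sigma> Q"
  proof (induction Q rule: poly_mapping_add_induct)
    case zero
    show ?case by simp
  next
    case (add Q t d)
    show ?case
      using add by (simp add: distrib_left psubst_add mult_single psubst_single msubst_add mult_ac)
  qed
  then show ?case using add by (simp add: distrib_right psubst_add)
qed

lemma prod_pvar_power: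
  fixes \<pi> :: "'x \<Rightarrow> 'y"
  shows "(\<Prod>x\<in>K. pvar (\<pi> x) ^ e x) = Poly_Mapping.single (\<Sum>x\<in>K. Poly_Mapping.single (\<pi> x) (e x)) 1"
proof -
  have pow: "pvar y ^ d = Poly_Mapping.single (Poly_Mapping.single y d) 1" for y :: 'y and d
    by (induction d) (auto simp: pvar_def mult_single simp flip: single_add)
  show ?thesis
    by (induction K rule: infinite_finite_induct) (auto simp: pow mult_single)
qed

text \<open>\<open>map_key\<close> precomposes the exponent function, so renaming each
  \<open>x\<close> to \<open>\<pi> x\<close> is pulling back along the inverse of
  \<open>\<pi>\<close>.\<close>

lemma sum_single_lookup_perm:
  assumes "bij \<pi>"
  shows "(\<Sum>x\<in>Poly_Mapping.keys t. Poly_Mapping.single (\<pi> x) (Poly_Mapping.lookup t x))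
           = Poly_Mapping.map_key (inv_into UNIV \<pi>) t"
proof (rule poly_mapping_eqI)
  fix y
  have inj: "inj (inv_into UNIV \<pi>)" using assms by (simp add: bij_imp_bij_inv bij_is_inj)
  have "(\<Sum>x\<in>Poly_Mapping.keys t. Poly_Mapping.lookup t x when \<pi> x = y)
       = (\<Sum>x\<in>Poly_Mapping.keys t. if x = inv_into UNIV \<pi> y then Poly_Mapping.lookup t x else 0)"
    by (intro sum.cong) (use assms in \<open>auto simp: when_def bij_inv_eq_iff\<close>)
  then show "Poly_Mapping.lookup (\<Sum>x\<in>Poly_Mapping.keys t.
          Poly_Mapping.single (\<pi> x) (Poly_Mapping.lookup t x)) y
      = Poly_Mapping.lookup (Poly_Mapping.map_key (inv_into UNIV \<pi>) t) y"
    by (auto simp: lookup_sum lookup_single sum.delta' in_keys_iff map_key.rep_eq[OF inj])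
qed

text \<open>Exactly one monomial is renamed to \<open>t\<close>, namely the pullback of
  \<open>t\<close> along \<open>\<pi>\<close>. Invariance under permutations thereby becomes a
  condition on coefficients.\<close>

lemma lookup_psubst_perm:
  assumes "bij \<pi>"
  shows "Poly_Mapping.lookup (psubst (\<lambda>x. pvar (\<pi> x)) P) t
           = Poly_Mapping.lookup P (Poly_Mapping.map_key \<pi> t)"
proof (induction P rule: poly_mapping_add_induct)
  case zero
  show ?case by simp
next
  case (add P u c)
  have inj: "inj \<pi>" "inj (inv_into UNIV \<pi>)"
    using assms by (simp_all add: bij_imp_bij_inv bij_is_inj)
  have "Poly_Mapping.map_key (inv_into UNIV \<pi>) u = t \<longleftrightarrow> u = Poly_Mapping.map_key \<pi> t"
    using assms inj
    by (auto simp: map_key_compose o_def bij_is_surj surj_f_inv_f map_key_id)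
  then show ?case
    using add
    by (auto simp: psubst_add lookup_add psubst_single msubst_def prod_pvar_power
        sum_single_lookup_perm[OF assms] mult_single lookup_single when_def
        simp flip: single_of_int)
qed

text \<open>A monomial with a variable in \<open>Z\<close> acquires a factor 0 with positive
  exponent and vanishes; the others are fixed. Composition, symmetry and degrees under
  \<open>set_zero\<close> are read off from this formula.\<close>

lemma lookup_set_zero:
  "Poly_Mapping.lookup (set_zero Z P) t
     = (if Poly_Mapping.keys t \<inter> Z = {} then Poly_Mapping.lookup P t else 0)"
proof (induction P rule: poly_mapping_add_induct)
  case zero
  show ?case by (simp add: set_zero_def)
next
  case (add P u c)
  let ?\<sigma> = "\<lambda>x. if x \<in> Z then 0 else pvar x"
  have "msubst ?\<sigma> u = (if Poly_Mapping.keys u \<inter> Z = {} then Poly_Mapping.single u 1 else 0)"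
  proof (cases "Poly_Mapping.keys u \<inter> Z = {}")
    case True
    \<comment> \<open>Writing \<open>id x\<close> presents the product as a renaming by the
      identity, so that the formulas for renamed monomials return \<open>u\<close>.\<close>
    then have "msubst ?\<sigma> u = (\<Prod>x\<in>Poly_Mapping.keys u. pvar (id x) ^ Poly_Mapping.lookup u x)"
      unfolding msubst_def by (intro prod.cong) auto
    then show ?thesis
      using True sum_single_lookup_perm[of id u]
      by (simp add: prod_pvar_power map_key_id[unfolded id_def[symmetric]])
  next
    case False
    then obtain x where "x \<in> Poly_Mapping.keys u" "x \<in> Z" by auto
    then have "msubst ?\<sigma> u = 0"
      unfolding msubst_def by (intro prod_zero bexI[of _ x]) (auto simp: in_keys_iff zero_power)
    then show ?thesis using False by simp
  qed
  then show ?case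
    using add unfolding set_zero_def
    by (auto simp: psubst_add lookup_add psubst_single mult_single lookup_single when_def
        simp flip: single_of_int)
qed

lemma set_zero_0 [simp]: "set_zero Z 0 = 0"
  and set_zero_1 [simp]: "set_zero Z 1 = 1"
  and set_zero_add: "set_zero Z (P + Q) = set_zero Z P + set_zero Z Q"
  and set_zero_mult: "set_zero Z (P * Q) = set_zero Z P * set_zero Z Q"
  by (simp_all add: set_zero_def psubst_add psubst_mult)

lemma set_zero_set_zero: "set_zero Y (set_zero Z P) = set_zero (Y \<union> Z) P"
  by (intro poly_mapping_eqI) (auto simp: lookup_set_zero)

lemma pvars_subset_iff:
  "pvars P \<subseteq> S \<longleftrightarrow> (\<forall>t. Poly_Mapping.lookup P t \<noteq> 0 \<longrightarrow> Poly_Mapping.keys t \<subseteq> S)"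
  unfolding pvars_def UN_subset_iff in_keys_iff Ball_def by (rule refl)

text \<open>Turns a bound on the variables into a fixed-point equation. As \<open>set_zero\<close>
  respects the ring operations, closure of \<open>sym_polys S\<close> under them follows without
  inspecting monomials.\<close>

lemma set_zero_Compl_eq_iff: "set_zero (- S) P = P \<longleftrightarrow> pvars P \<subseteq> S"
  unfolding pvars_subset_iff poly_mapping_eq_iff fun_eq_iff lookup_set_zero
  by (auto split: if_splits)

lemma set_zero_cong:
  assumes "pvars P \<subseteq> S" "S \<inter> Y = S \<inter> Z"
  shows "set_zero Y P = set_zero Z P"
proof (rule poly_mapping_eqI)
  fix t
  show "Poly_Mapping.lookup (set_zero Y P) t = Poly_Mapping.lookup (set_zero Z P) t"
  proof (cases "Poly_Mapping.lookup P t = 0")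
    case False
    then have "Poly_Mapping.keys t \<subseteq> S" using assms(1) pvars_subset_iff by metis
    then have "Poly_Mapping.keys t \<inter> Y = {} \<longleftrightarrow> Poly_Mapping.keys t \<inter> Z = {}"
      using assms(2) by blast
    then show ?thesis by (simp add: lookup_set_zero)
  qed (simp add: lookup_set_zero)
qed

section \<open>Exponent types and symmetric polynomials\<close>

text \<open>A multiset of positive integers is a partition, here of the total degree of
  \<open>t\<close>. Its parts are the exponents with the variables forgotten.\<close>

definition mtype :: "('x \<Rightarrow>\<^sub>0 nat) \<Rightarrow> nat multiset" where
  "mtype t = image_mset (Poly_Mapping.lookup t) (mset_set (Poly_Mapping.keys t))"

lemma size_mtype: "size (mtype t) = card (Poly_Mapping.keys t)"
  by (simp add: mtype_def)

lemma zero_notin_mtype: "0 \<notin># mtype t"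
  by (auto simp: mtype_def in_keys_iff)

text \<open>A partition of \<open>D\<close> has at most \<open>D\<close> parts; this is the source
  of the bound \<open>D\<close> on the number of variables needed.\<close>

lemma size_le_sum_mset: "0 \<notin># M \<Longrightarrow> size M \<le> sum_mset M" for M :: "nat multiset"
  by (induction M) auto

text \<open>Variables of \<open>A\<close> outside the support contribute only zeros, and their
  number depends on \<open>t\<close> only through its type. Two monomials of equal type thus have
  equal exponent multisets over any common finite superset of their supports.\<close>

lemma image_mset_lookup:
  assumes "finite A" "Poly_Mapping.keys t \<subseteq> A"
  shows "image_mset (Poly_Mapping.lookup t) (mset_set A)
           = mtype t + replicate_mset (card A - size (mtype t)) 0"
proof -
  have "mset_set A = mset_set (Poly_Mapping.keys t) + mset_set (A - Poly_Mapping.keys t)"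
    using assms by (metis finite_keys finite_Diff mset_set_Union Diff_disjoint Un_Diff_cancel sup.absorb2)
  moreover have "image_mset (Poly_Mapping.lookup t) (mset_set (A - Poly_Mapping.keys t))
      = image_mset (\<lambda>_. 0) (mset_set (A - Poly_Mapping.keys t))"
    by (intro image_mset_cong) (use assms(1) in \<open>auto simp: in_keys_iff\<close>)
  ultimately show ?thesis
    using assms by (simp add: mtype_def image_mset_const_eq card_Diff_subset)
qed

text \<open>Over the union of the two supports, a finite set even if \<open>S\<close> is infinite,
  the exponents form equal multisets and are matched by a permutation. It extends to
  \<open>S\<close> by the identity.\<close>

lemma mtype_eq_imp_permutes:
  assumes "mtype t = mtype u" "Poly_Mapping.keys t \<subseteq> S" "Poly_Mapping.keys u \<subseteq> S"
  obtains \<pi> where "\<pi> permutes S" "t = Poly_Mapping.map_key \<pi> u"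
proof -
  let ?A = "Poly_Mapping.keys t \<union> Poly_Mapping.keys u"
  have "image_mset (Poly_Mapping.lookup t) (mset_set ?A)
      = image_mset (Poly_Mapping.lookup u) (mset_set ?A)"
    by (simp add: image_mset_lookup assms(1))
  then obtain \<pi> where \<pi>: "\<pi> permutes ?A"
      "\<forall>x\<in>?A. Poly_Mapping.lookup t x = Poly_Mapping.lookup u (\<pi> x)"
    by (rule image_mset_eq_implies_permutes[rotated]) auto
  have "t = Poly_Mapping.map_key \<pi> u"
  proof (rule poly_mapping_eqI)
    fix x
    show "Poly_Mapping.lookup t x = Poly_Mapping.lookup (Poly_Mapping.map_key \<pi> u) x"
    proof (cases "x \<in> ?A")
      case False
      then have "\<pi> x = x" using \<pi>(1) by (meson permutes_not_in)
      then show ?thesis using False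
        by (simp add: map_key.rep_eq permutes_inj[OF \<pi>(1)] in_keys_iff)
    qed (use \<pi>(2) in \<open>simp add: map_key.rep_eq permutes_inj[OF \<pi>(1)]\<close>)
  qed
  moreover have "\<pi> permutes S" using \<pi>(1) assms by (meson permutes_subset Un_least)
  ultimately show thesis by (rule that[rotated])
qed

lemma mtype_map_key:
  assumes "bij \<pi>"
  shows "mtype (Poly_Mapping.map_key \<pi> t) = mtype t"
proof -
  have inj: "inj \<pi>" using assms by (simp add: bij_is_inj)
  have "Poly_Mapping.keys t = \<pi> ` (\<pi> -` Poly_Mapping.keys t)"
    using assms by (simp add: bij_is_surj)
  then have "mset_set (Poly_Mapping.keys t) = image_mset \<pi> (mset_set (\<pi> -` Poly_Mapping.keys t))"
    by (metis image_mset_mset_set inj inj_on_subset subset_UNIV)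
  then show ?thesis
    by (simp add: mtype_def keys_map_key[OF inj] map_key.rep_eq[OF inj] image_mset.compositionality o_def)
qed

lemma exists_mtype:
  assumes "0 \<notin># M" "size M \<le> card S"
  shows "\<exists>t. Poly_Mapping.keys t \<subseteq> S \<and> mtype t = M"
  using assms
proof (induction M)
  case empty
  show ?case by (intro exI[of _ 0]) (simp add: mtype_def)
next
  case (add a M)
  then obtain t where t: "Poly_Mapping.keys t \<subseteq> S" "mtype t = M" by auto
  then have "card (Poly_Mapping.keys t) < card S" using add.prems size_mtype[of t] by simp
  then obtain x where x: "x \<in> S" "x \<notin> Poly_Mapping.keys t"
    using t(1) by (metis less_irrefl subsetI subset_antisym)
  define u where "u = t + Poly_Mapping.single x a"
  have keys: "Poly_Mapping.keys u = insert x (Poly_Mapping.keys t)"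
    using add.prems
    by (auto simp: u_def in_keys_iff lookup_add lookup_single when_def split: if_splits)
  have "image_mset (Poly_Mapping.lookup u) (mset_set (Poly_Mapping.keys t))
      = image_mset (Poly_Mapping.lookup t) (mset_set (Poly_Mapping.keys t))"
    by (intro image_mset_cong) (use x in \<open>auto simp: u_def lookup_add lookup_single when_def\<close>)
  moreover have "Poly_Mapping.lookup u x = a"
    using x(2) by (simp add: u_def lookup_add in_keys_iff)
  ultimately have "mtype u = add_mset a M"
    using x(2) t(2) by (simp add: mtype_def keys)
  then show ?case using keys x(1) t(1) by (intro exI[of _ u]) auto
qed

text \<open>The monomials in \<open>S\<close> of one type form exactly one orbit under the
  permutations of \<open>S\<close>, by \<open>mtype_eq_imp_permutes\<close> and
  \<open>mtype_map_key\<close>. Invariance means that coefficients are constant on orbits.\<close>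

lemma sym_polys_iff:
  fixes P :: "'x zpoly"
  shows "P \<in> sym_polys S \<longleftrightarrow> pvars P \<subseteq> S \<and>
     (\<forall>t u. Poly_Mapping.keys t \<subseteq> S \<longrightarrow> Poly_Mapping.keys u \<subseteq> S \<longrightarrow> mtype t = mtype u \<longrightarrow>
        Poly_Mapping.lookup P t = Poly_Mapping.lookup P u)"
proof (intro iffI conjI allI impI)
  fix t u :: "'x \<Rightarrow>\<^sub>0 nat"
  assume P: "P \<in> sym_polys S" and tu: "Poly_Mapping.keys t \<subseteq> S" "Poly_Mapping.keys u \<subseteq> S"
    "mtype t = mtype u"
  obtain \<pi> where \<pi>: "\<pi> permutes S" "t = Poly_Mapping.map_key \<pi> u"
    using mtype_eq_imp_permutes[OF tu(3,1,2)] .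
  have "Poly_Mapping.lookup P u = Poly_Mapping.lookup (psubst (\<lambda>x. pvar (\<pi> x)) P) u"
    using P \<pi>(1) by (simp add: sym_polys_def)
  then show "Poly_Mapping.lookup P t = Poly_Mapping.lookup P u"
    by (simp add: lookup_psubst_perm permutes_bij[OF \<pi>(1)] \<pi>(2))
next
  assume P: "pvars P \<subseteq> S \<and>
     (\<forall>t u. Poly_Mapping.keys t \<subseteq> S \<longrightarrow> Poly_Mapping.keys u \<subseteq> S \<longrightarrow> mtype t = mtype u \<longrightarrow>
        Poly_Mapping.lookup P t = Poly_Mapping.lookup P u)"
  have "psubst (\<lambda>x. pvar (\<pi> x)) P = P" if \<pi>: "\<pi> permutes S" for \<pi>
  proof (rule poly_mapping_eqI)
    fix t :: "'x \<Rightarrow>\<^sub>0 nat"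
    \<comment> \<open>The hypothesis on types speaks only of monomials in \<open>S\<close>. By this
      equivalence the remaining ones are permuted among themselves, and their coefficients are all
      0.\<close>
    have "Poly_Mapping.keys (Poly_Mapping.map_key \<pi> t) \<subseteq> S \<longleftrightarrow> Poly_Mapping.keys t \<subseteq> S"
      by (metis keys_map_key \<pi> permutes_inj permutes_vimage permutes_surj surj_image_vimage_eq
          image_mono vimage_mono permutes_image)
    then have "Poly_Mapping.lookup P (Poly_Mapping.map_key \<pi> t) = Poly_Mapping.lookup P t"
      using P mtype_map_key[OF permutes_bij[OF \<pi>]] unfolding pvars_subset_iff by metis
    then show "Poly_Mapping.lookup (psubst (\<lambda>x. pvar (\<pi> x)) P) t = Poly_Mapping.lookup P t"
      by (simp add: lookup_psubst_perm permutes_bij[OF \<pi>])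
  qed
  then show "P \<in> sym_polys S" using P by (simp add: sym_polys_def)
qed (auto simp: sym_polys_def)

section \<open>The graded ring of symmetric polynomials\<close>

lemma pvars_mult:
  assumes "pvars P \<subseteq> S" "pvars Q \<subseteq> S"
  shows "pvars (P * Q) \<subseteq> S"
  using assms by (simp add: set_zero_mult flip: set_zero_Compl_eq_iff)

lemma sym_polys_0: "0 \<in> sym_polys S"
  and sym_polys_1: "1 \<in> sym_polys S"
  by (simp_all add: sym_polys_def flip: set_zero_Compl_eq_iff)

lemma sym_polys_add: "P \<in> sym_polys S \<Longrightarrow> Q \<in> sym_polys S \<Longrightarrow> P + Q \<in> sym_polys S"
  by (simp add: sym_polys_def psubst_add set_zero_add flip: set_zero_Compl_eq_iff)

lemma sym_polys_uminus: "P \<in> sym_polys S \<Longrightarrow> - P \<in> sym_polys S"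
  by (simp add: sym_polys_def psubst_uminus set_zero_def flip: set_zero_Compl_eq_iff)

lemma sym_polys_mult: "P \<in> sym_polys S \<Longrightarrow> Q \<in> sym_polys S \<Longrightarrow> P * Q \<in> sym_polys S"
  by (simp add: sym_polys_def psubst_mult pvars_mult)

definition mdeg :: "('x \<Rightarrow>\<^sub>0 nat) \<Rightarrow> nat" where
  "mdeg t = (\<Sum>x\<in>Poly_Mapping.keys t. Poly_Mapping.lookup t x)"

lemma sum_mset_mtype: "sum_mset (mtype t) = mdeg t"
  by (simp add: mtype_def mdeg_def sum_unfold_sum_mset)

lemma mdeg_0 [simp]: "mdeg 0 = 0"
  by (simp add: mdeg_def)

lemma mdeg_superset:
  "finite A \<Longrightarrow> Poly_Mapping.keys t \<subseteq> A \<Longrightarrow> mdeg t = (\<Sum>x\<in>A. Poly_Mapping.lookup t x)"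
  unfolding mdeg_def by (intro sum.mono_neutral_left) (auto simp: in_keys_iff)

lemma mdeg_add: "mdeg (s + t) = mdeg s + mdeg t"
proof -
  let ?A = "Poly_Mapping.keys s \<union> Poly_Mapping.keys t"
  have "mdeg (s + t) = (\<Sum>x\<in>?A. Poly_Mapping.lookup (s + t) x)"
    by (intro mdeg_superset) (auto simp: keys_add)
  then show ?thesis by (simp add: mdeg_superset[of ?A] lookup_add sum.distrib)
qed

lemma homogeneous_iff: "homogeneous r P \<longleftrightarrow> (\<forall>t. Poly_Mapping.lookup P t \<noteq> 0 \<longrightarrow> mdeg t = r)"
  by (simp add: homogeneous_def mdeg_def in_keys_iff Ball_def)

lemma homogeneous_mult:
  assumes "homogeneous i P" "homogeneous j Q"
  shows "homogeneous (i + j) (P * Q)"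
  unfolding homogeneous_iff
proof (intro allI impI)
  fix t
  assume "Poly_Mapping.lookup (P * Q) t \<noteq> 0"
  then obtain u v where "t = u + v" "u \<in> Poly_Mapping.keys P" "v \<in> Poly_Mapping.keys Q"
    using keys_mult[of P Q] by (auto simp flip: in_keys_iff)
  then show "mdeg t = i + j" using assms by (simp add: homogeneous_iff mdeg_add in_keys_iff)
qed

definition hcomp :: "nat \<Rightarrow> 'x zpoly \<Rightarrow> 'x zpoly" where
  "hcomp r P = Poly_Mapping.mapp (\<lambda>t c. c when mdeg t = r) P"

lemma lookup_hcomp: "Poly_Mapping.lookup (hcomp r P) t = (Poly_Mapping.lookup P t when mdeg t = r)"
  by (auto simp: hcomp_def lookup_mapp when_def in_keys_iff)

lemma homogeneous_hcomp: "homogeneous r (hcomp r P)"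
  by (simp add: homogeneous_iff lookup_hcomp)

lemma hcomp_sym_polys: "P \<in> sym_polys S \<Longrightarrow> hcomp r P \<in> sym_polys S"
proof -
  assume P: "P \<in> sym_polys S"
  have "Poly_Mapping.lookup (hcomp r P) t = Poly_Mapping.lookup (hcomp r P) u"
    if "Poly_Mapping.keys t \<subseteq> S" "Poly_Mapping.keys u \<subseteq> S" "mtype t = mtype u" for t u
  proof -
    have "mdeg t = mdeg u" using that(3) by (simp flip: sum_mset_mtype)
    moreover have "Poly_Mapping.lookup P t = Poly_Mapping.lookup P u"
      using P that unfolding sym_polys_iff by blast
    ultimately show ?thesis by (simp add: lookup_hcomp)
  qed
  moreover have "pvars (hcomp r P) \<subseteq> S"
    using P by (simp add: sym_polys_def pvars_subset_iff lookup_hcomp)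
  ultimately show ?thesis unfolding sym_polys_iff by blast
qed

lemma hcomp_set_zero: "hcomp r (set_zero Z P) = set_zero Z (hcomp r P)"
  by (intro poly_mapping_eqI) (simp add: lookup_hcomp lookup_set_zero)

lemma sum_hcomp:
  assumes "finite B" "\<And>t. Poly_Mapping.lookup P t \<noteq> 0 \<Longrightarrow> mdeg t \<in> B"
  shows "(\<Sum>r\<in>B. hcomp r P) = P"
proof (rule poly_mapping_eqI)
  fix t
  have "(\<Sum>r\<in>B. Poly_Mapping.lookup (hcomp r P) t)
      = (\<Sum>r\<in>B. if r = mdeg t then Poly_Mapping.lookup P t else 0)"
    by (intro sum.cong) (auto simp: lookup_hcomp)
  then show "Poly_Mapping.lookup (\<Sum>r\<in>B. hcomp r P) t = Poly_Mapping.lookup P t"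
    using assms by (auto simp: lookup_sum)
qed

text \<open>Terms of different degrees share no monomials, so each summand can be recovered from the
  sum. This yields uniqueness of the homogeneous decomposition.\<close>

lemma hcomp_sum:
  assumes "finite B" "\<And>r. r \<in> B \<Longrightarrow> homogeneous r (f r)"
  shows "hcomp r (\<Sum>r\<in>B. f r) = (if r \<in> B then f r else 0)"
proof (rule poly_mapping_eqI)
  fix t
  have "(\<Sum>s\<in>B. Poly_Mapping.lookup (f s) t)
      = (\<Sum>s\<in>B. if s = mdeg t then Poly_Mapping.lookup (f s) t else 0)"
    by (intro sum.cong) (use assms in \<open>auto simp: homogeneous_iff\<close>)
  then show "Poly_Mapping.lookup (hcomp r (\<Sum>r\<in>B. f r)) t
      = Poly_Mapping.lookup (if r \<in> B then f r else 0) t"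
    using assms by (auto simp: lookup_hcomp lookup_sum homogeneous_iff when_def)
qed

lemma sym_ring_simps [simp]:
  "carrier (sym_ring S) = sym_polys S"
  "monoid.mult (sym_ring S) = (*)"
  "one (sym_ring S) = 1"
  "zero (sym_ring S) = 0"
  "add (sym_ring S) = (+)"
  "homog (sym_ring S) r = {P \<in> sym_polys S. homogeneous r P}"
  by (simp_all add: sym_ring_def)

lemma ring_sym_ring: "ring (sym_ring S)"
proof (rule ringI)
  show "abelian_group (sym_ring S)"
  proof (rule abelian_groupI)
    fix P assume "P \<in> carrier (sym_ring S)"
    then show "\<exists>Q\<in>carrier (sym_ring S). Q \<oplus>\<^bsub>sym_ring S\<^esub> P = \<zero>\<^bsub>sym_ring S\<^esub>"
      using sym_polys_uminus[of P S] by force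
  qed (auto simp: sym_polys_add sym_polys_0)
  show "monoid (sym_ring S)"
    by (rule monoidI) (auto simp: sym_polys_mult sym_polys_1 mult.assoc)
qed (auto simp: distrib_left distrib_right)

lemma finsum_sym_ring:
  assumes "finite B" "\<And>b. b \<in> B \<Longrightarrow> f b \<in> sym_polys S"
  shows "finsum (sym_ring S) f B = (\<Sum>b\<in>B. f b)"
proof -
  interpret ring "sym_ring S" by (rule ring_sym_ring)
  show ?thesis using assms by (induction B rule: finite_induct) auto
qed

lemma graded_ring_sym_ring: "graded_ring (sym_ring S)"
proof -
  interpret ring "sym_ring S" by (rule ring_sym_ring)
  show ?thesis
  proof (intro graded_ring.intro graded_ring_axioms.intro ring_sym_ring)
    fix r
    show "subgroup (homog (sym_ring S) r) (add_monoid (sym_ring S))"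
    proof (rule add.subgroupI)
      have "0 \<in> homog (sym_ring S) r" by (simp add: sym_polys_0 homogeneous_iff)
      then show "homog (sym_ring S) r \<noteq> {}" by auto
    next
      fix P assume P: "P \<in> homog (sym_ring S) r"
      then have "\<ominus>\<^bsub>sym_ring S\<^esub> P = - P"
        using minus_equality[of "- P" P] sym_polys_uminus[of P S] by simp
      then show "\<ominus>\<^bsub>sym_ring S\<^esub> P \<in> homog (sym_ring S) r"
        using P by (simp add: homogeneous_iff sym_polys_uminus)
    next
      fix P Q assume "P \<in> homog (sym_ring S) r" "Q \<in> homog (sym_ring S) r"
      then show "P \<oplus>\<^bsub>sym_ring S\<^esub> Q \<in> homog (sym_ring S) r"
        by (auto simp: homogeneous_iff lookup_add intro: sym_polys_add) (metis add.left_neutral)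
    qed auto
  next
    show "\<one>\<^bsub>sym_ring S\<^esub> \<in> homog (sym_ring S) 0"
      by (auto simp: homogeneous_iff lookup_one when_def sym_polys_1)
  next
    fix P Q i j assume "P \<in> homog (sym_ring S) i" "Q \<in> homog (sym_ring S) j"
    then show "P \<otimes>\<^bsub>sym_ring S\<^esub> Q \<in> homog (sym_ring S) (i + j)"
      by (simp add: sym_polys_mult homogeneous_mult)
  next
    fix P assume P: "P \<in> carrier (sym_ring S)"
    let ?D = "\<lambda>f. (\<forall>r. f r \<in> homog (sym_ring S) r) \<and> finite {r. f r \<noteq> \<zero>\<^bsub>sym_ring S\<^esub>} \<and>
        P = finsum (sym_ring S) f {r. f r \<noteq> \<zero>\<^bsub>sym_ring S\<^esub>}"
    show "\<exists>!f. ?D f"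
    proof (rule ex1I[of _ "\<lambda>r. hcomp r P"])
      have sub: "{r. hcomp r P \<noteq> 0} \<subseteq> mdeg ` Poly_Mapping.keys P"
        by (auto simp: poly_mapping_eq_iff fun_eq_iff lookup_hcomp in_keys_iff)
      then have fin: "finite {r. hcomp r P \<noteq> 0}" by (rule finite_subset) simp
      have "(\<Sum>r\<in>{r. hcomp r P \<noteq> 0}. hcomp r P) = P"
      proof (rule sum_hcomp[OF fin])
        fix t assume "Poly_Mapping.lookup P t \<noteq> 0"
        then have "Poly_Mapping.lookup (hcomp (mdeg t) P) t \<noteq> 0" by (simp add: lookup_hcomp)
        then show "mdeg t \<in> {r. hcomp r P \<noteq> 0}" by auto
      qed
      moreover have "finsum (sym_ring S) (\<lambda>r. hcomp r P) {r. hcomp r P \<noteq> 0}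
          = (\<Sum>r\<in>{r. hcomp r P \<noteq> 0}. hcomp r P)"
        by (rule finsum_sym_ring[OF fin]) (use P hcomp_sym_polys in simp)
      ultimately show "?D (\<lambda>r. hcomp r P)"
        using P fin by (simp add: homogeneous_hcomp hcomp_sym_polys)
    next
      fix f assume f: "?D f"
      have fin: "finite {r. f r \<noteq> 0}"
        using f[THEN conjunct2, THEN conjunct1] by simp
      have fr: "f r \<in> sym_polys S \<and> homogeneous r (f r)" for r
        using f[THEN conjunct1] by simp
      have P_f: "P = finsum (sym_ring S) f {r. f r \<noteq> 0}"
        using f[THEN conjunct2, THEN conjunct2] by (simp only: sym_ring_simps)
      have "P = (\<Sum>r\<in>{r. f r \<noteq> 0}. f r)"
        using P_f finsum_sym_ring[OF fin, of f S] fr by simp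
      then have "hcomp r P = f r" for r
        using hcomp_sum[OF fin, of f r] fr by auto
      then show "f = (\<lambda>r. hcomp r P)" by auto
    qed
  qed
qed

text \<open>The monomials in \<open>S\<close> are those in \<open>T\<close> that
  \<open>set_zero Z\<close> keeps, with unchanged coefficients. The criterion by types for
  \<open>T\<close> therefore restricts to \<open>S\<close>.\<close>

lemma sym_polys_set_zero:
  assumes "P \<in> sym_polys T" "T - Z = S"
  shows "set_zero Z P \<in> sym_polys S"
proof -
  have *: "Poly_Mapping.keys t \<subseteq> S \<longleftrightarrow> Poly_Mapping.keys t \<subseteq> T \<and> Poly_Mapping.keys t \<inter> Z = {}"
    for t :: "_ \<Rightarrow>\<^sub>0 nat"
    using assms(2) by blast
  show ?thesis
    using assms(1) unfolding sym_polys_iff pvars_subset_iff * by (auto simp: lookup_set_zero)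
qed

lemma graded_ring_hom_set_zero:
  assumes "T - Z = S"
  shows "graded_ring_hom (sym_ring T) (sym_ring S) (set_zero Z)"
proof -
  have "set_zero Z \<in> ring_hom (sym_ring T) (sym_ring S)"
    using sym_polys_set_zero[OF _ assms]
    by (intro ring_hom_memI) (simp_all add: set_zero_add set_zero_mult)
  moreover have "set_zero Z P \<in> homog (sym_ring S) r" if "P \<in> homog (sym_ring T) r" for P r
    using that sym_polys_set_zero[OF _ assms] by (simp add: homogeneous_iff lookup_set_zero)
  ultimately show ?thesis
    by (simp only: graded_ring_hom_def graded_ring_sym_ring image_subset_iff) blast
qed

section \<open>Symmetric functions as functions on exponent types\<close>

definition bounded_degree :: "(nat multiset \<Rightarrow> int) \<Rightarrow> bool" where
  "bounded_degree g \<longleftrightarrow> (\<exists>D. \<forall>M. g M \<noteq> 0 \<longrightarrow> sum_mset M \<le> D)"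

text \<open>
  The polynomial \<open>\<Sum>\<^sub>\<lambda> g \<lambda> m\<^sub>\<lambda>\<close> in the variables \<open>S\<close>, where \<open>m\<^sub>\<lambda>\<close> is the monomial symmetric
  polynomial. It is junk unless \<open>S\<close> is finite and \<open>g\<close> is of bounded degree.
\<close>

definition sym_poly :: "(nat multiset \<Rightarrow> int) \<Rightarrow> 'x set \<Rightarrow> 'x zpoly" where
  "sym_poly g S =
     Poly_Mapping.Abs_poly_mapping (\<lambda>t. if Poly_Mapping.keys t \<subseteq> S then g (mtype t) else 0)"

text \<open>Exponents are bounded by the degree, which leaves finitely many exponent functions on a
  finite \<open>S\<close>. The finite support that \<open>Abs_poly_mapping\<close> presupposes in
  \<open>sym_poly\<close> comes from here.\<close>

lemma finite_monomials:
  fixes S :: "'x set"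
  assumes "finite S"
  shows "finite {t :: 'x \<Rightarrow>\<^sub>0 nat. Poly_Mapping.keys t \<subseteq> S \<and> mdeg t \<le> D}" (is "finite ?A")
proof (rule finite_imageD)
  have "Poly_Mapping.lookup t x \<le> D" if "Poly_Mapping.keys t \<subseteq> S" "mdeg t \<le> D" for t x
  proof (cases "x \<in> Poly_Mapping.keys t")
    case True
    then have "Poly_Mapping.lookup t x \<le> mdeg t"
      unfolding mdeg_def by (intro member_le_sum) auto
    then show ?thesis using that(2) by simp
  qed (simp add: in_keys_iff)
  then have "Poly_Mapping.lookup ` ?A
      \<subseteq> {e. \<forall>x. (x \<in> S \<longrightarrow> e x \<in> {..D}) \<and> (x \<notin> S \<longrightarrow> e x = 0)}"
    by (auto simp: in_keys_iff)
  then show "finite (Poly_Mapping.lookup ` ?A)"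
    by (rule finite_subset) (intro finite_set_of_finite_funs assms finite_atMost)
  show "inj_on Poly_Mapping.lookup ?A" by (auto intro: inj_onI poly_mapping_eqI)
qed

lemma lookup_sym_poly:
  assumes "finite S" "bounded_degree g"
  shows "Poly_Mapping.lookup (sym_poly g S) t
           = (if Poly_Mapping.keys t \<subseteq> S then g (mtype t) else 0)"
proof -
  obtain D where D: "\<And>M. g M \<noteq> 0 \<Longrightarrow> sum_mset M \<le> D"
    using assms(2) unfolding bounded_degree_def by blast
  have "{t. (if Poly_Mapping.keys t \<subseteq> S then g (mtype t) else 0) \<noteq> 0}
      \<subseteq> {t. Poly_Mapping.keys t \<subseteq> S \<and> mdeg t \<le> D}"
    using D by (auto simp flip: sum_mset_mtype)
  then have "finite {t. (if Poly_Mapping.keys t \<subseteq> S then g (mtype t) else 0) \<noteq> 0}"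
    by (rule finite_subset) (rule finite_monomials[OF assms(1)])
  then show ?thesis unfolding sym_poly_def by (subst lookup_Abs_poly_mapping) auto
qed

lemma sym_poly_in_sym_polys:
  assumes "finite S" "bounded_degree g"
  shows "sym_poly g S \<in> sym_polys S"
  unfolding sym_polys_iff pvars_subset_iff by (simp add: lookup_sym_poly assms)

lemma set_zero_sym_poly:
  assumes "finite S" "bounded_degree g"
  shows "set_zero Z (sym_poly g S) = sym_poly g (S - Z)"
  by (rule poly_mapping_eqI) (auto simp: lookup_set_zero lookup_sym_poly assms)

text \<open>No type contains 0, so the value of a parameter at a multiset containing 0 is invisible.
  Parameters are unique only up to such values, which explains \<open>0 \<notin># M\<close> in the
  injectivity lemmas.\<close>

lemma sym_poly_cong:
  assumes "\<And>M. 0 \<notin># M \<Longrightarrow> g M = g' M"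
  shows "sym_poly g S = sym_poly g' S"
  unfolding sym_poly_def
  by (intro arg_cong[of _ _ Poly_Mapping.Abs_poly_mapping] ext) (simp add: assms zero_notin_mtype)

lemma sym_poly_inject:
  assumes "finite S" "bounded_degree g" "bounded_degree g'" "sym_poly g S = sym_poly g' S"
    and "0 \<notin># M" "size M \<le> card S"
  shows "g M = g' M"
proof -
  obtain t where t: "Poly_Mapping.keys t \<subseteq> S" "mtype t = M"
    using exists_mtype[OF assms(5,6)] by blast
  then show ?thesis
    using arg_cong[OF assms(4), of "\<lambda>P. Poly_Mapping.lookup P t"] assms(1-3)
    by (simp add: lookup_sym_poly)
qed

section \<open>Limits along directed systems of finite variable sets\<close>

definition sym_family :: "'i set \<Rightarrow> ('i \<Rightarrow> 'x set) \<Rightarrow> (nat multiset \<Rightarrow> int) \<Rightarrow> 'i \<Rightarrow> 'x zpoly" where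
  "sym_family I S g = (\<lambda>i\<in>I. sym_poly g (S i))"

lemma sym_family_cong:
  "(\<And>M. 0 \<notin># M \<Longrightarrow> g M = g' M) \<Longrightarrow> sym_family I S g = sym_family I S g'"
  unfolding sym_family_def by (intro restrict_ext sym_poly_cong)

text \<open>Three kinds of limit are instances: over all finite sets of indeterminates, over growing
  word length, and over growing first index. By \<open>unbounded\<close> every type occurs in some
  \<open>S i\<close>, and by \<open>upper\<close> any two components can be compared inside a
  third.\<close>

locale sym_system =
  fixes I :: "'i::order set" and S :: "'i \<Rightarrow> 'x set" and f :: "'i \<Rightarrow> 'i \<Rightarrow> 'x zpoly \<Rightarrow> 'x zpoly"
  assumes upper: "i \<in> I \<Longrightarrow> j \<in> I \<Longrightarrow> \<exists>l\<in>I. i \<le> l \<and> j \<le> l"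
    and fin: "i \<in> I \<Longrightarrow> finite (S i)"
    and mono: "i \<in> I \<Longrightarrow> j \<in> I \<Longrightarrow> i \<le> j \<Longrightarrow> S i \<subseteq> S j"
    and f_eq: "i \<in> I \<Longrightarrow> j \<in> I \<Longrightarrow> i \<le> j \<Longrightarrow> P \<in> sym_polys (S j) \<Longrightarrow>
      f j i P = set_zero (S j - S i) P"
    and unbounded: "\<exists>i\<in>I. N \<le> card (S i)"
begin

lemma transition_hom:
  assumes "i \<in> I" "j \<in> I" "i \<le> j"
  shows "graded_ring_hom (sym_ring (S j)) (sym_ring (S i)) (f j i)"
proof (rule graded_ring_hom_cong[OF graded_ring_hom_set_zero])
  show "S j - (S j - S i) = S i" using mono[OF assms] by blast
qed (use f_eq assms in auto)

lemma directed_sym_rings: "directed_graded_family I (\<lambda>i. sym_ring (S i)) f"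
  unfolding directed_graded_family_def
proof (intro conjI ballI impI)
  show "I \<noteq> {}" using unbounded by blast
next
  fix i P assume "i \<in> I" "P \<in> carrier (sym_ring (S i))"
  then show "f i i P = P"
    by (simp add: f_eq) (simp add: poly_mapping_eq_iff fun_eq_iff lookup_set_zero)
next
  fix i j l P
  assume ijl: "i \<in> I" "j \<in> I" "l \<in> I" "i \<le> j" "j \<le> l" and P: "P \<in> carrier (sym_ring (S l))"
  have sub: "S i \<subseteq> S j" "S j \<subseteq> S l" using ijl mono by blast+
  then have "set_zero (S l - S j) P \<in> sym_polys (S j)"
    using P by (intro sym_polys_set_zero[of P "S l"]) auto
  moreover have "(S j - S i) \<union> (S l - S j) = S l - S i" using sub by blast
  moreover have "i \<le> l" using ijl by simp
  ultimately show "f j i (f l j P) = f l i P" using ijl P by (simp add: f_eq set_zero_set_zero)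
qed (use upper transition_hom in auto)

sublocale graded_family I "\<lambda>i. sym_ring (S i)" f
  by unfold_locales (rule directed_sym_rings)

text \<open>Membership requires a finite sum of compatible homogeneous families. The degree
  components of \<open>sym_poly g (S i)\<close> are compatible because \<open>hcomp\<close> commutes
  with \<open>set_zero\<close>, and the degree bound of \<open>g\<close> confines them to
  \<open>{..D}\<close> for all \<open>i\<close> at once.\<close>

lemma sym_family_in_carrier:
  assumes "bounded_degree g"
  shows "sym_family I S g \<in> carrier L"
proof -
  obtain D where D: "\<And>M. g M \<noteq> 0 \<Longrightarrow> sum_mset M \<le> D"
    using assms unfolding bounded_degree_def by blast
  let ?P = "\<lambda>i. sym_poly g (S i)"
  have P: "?P i \<in> sym_polys (S i)" if "i \<in> I" for i
    using that assms fin sym_poly_in_sym_polys by blast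
  show ?thesis
  proof (rule lim_carrierI[of "{..D}" "\<lambda>r. \<lambda>i\<in>I. hcomp r (?P i)"])
    fix r
    have "f j i (hcomp r (?P j)) = hcomp r (?P i)" if "i \<in> I" "j \<in> I" "i \<le> j" for i j
    proof -
      have "S j - (S j - S i) = S i" using mono[OF that] by blast
      then show ?thesis
        using that P fin assms
        by (simp add: f_eq hcomp_sym_polys set_zero_sym_poly flip: hcomp_set_zero)
    qed
    then show "(\<lambda>i\<in>I. hcomp r (?P i)) \<in> homog L r"
      by (simp add: lim_homog_iff P hcomp_sym_polys homogeneous_hcomp)
  next
    show "sym_family I S g = (\<lambda>i\<in>I. \<Oplus>\<^bsub>sym_ring (S i)\<^esub>r\<in>{..D}. (\<lambda>i\<in>I. hcomp r (?P i)) i)"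
      unfolding sym_family_def
    proof (rule restrict_ext)
      fix i assume i: "i \<in> I"
      have "?P i = (\<Sum>r\<in>{..D}. hcomp r (?P i))"
        by (rule sum_hcomp[symmetric])
          (use D fin[OF i] assms in \<open>auto simp: lookup_sym_poly simp flip: sum_mset_mtype split: if_splits\<close>)
      also have "\<dots> = (\<Oplus>\<^bsub>sym_ring (S i)\<^esub>r\<in>{..D}. (\<lambda>i\<in>I. hcomp r (?P i)) i)"
        using i P[OF i] by (subst finsum_sym_ring) (auto simp: hcomp_sym_polys)
      finally show "?P i = (\<Oplus>\<^bsub>sym_ring (S i)\<^esub>r\<in>{..D}. (\<lambda>i\<in>I. hcomp r (?P i)) i)" .
    qed
  qed simp
qed

text \<open>Adding one homogeneous family of degree \<open>r\<close> raises the bound to at most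
  \<open>max r D\<close>. The point is that one bound serves all components, which does not follow
  from each component being a polynomial.\<close>

lemma carrier_degree_bound:
  assumes "x \<in> carrier L"
  shows "\<exists>D. \<forall>i\<in>I. \<forall>t. Poly_Mapping.lookup (x i) t \<noteq> 0 \<longrightarrow> mdeg t \<le> D"
  using assms
proof (induction rule: lim_carrier_induct)
  case zero
  show ?case by (simp add: L_simps)
next
  case (add r h y)
  then obtain D where D: "\<And>i t. i \<in> I \<Longrightarrow> Poly_Mapping.lookup (y i) t \<noteq> 0 \<Longrightarrow> mdeg t \<le> D"
    by blast
  have h: "mdeg t = r" if "i \<in> I" "Poly_Mapping.lookup (h i) t \<noteq> 0" for i t
    using add(1) that by (auto simp: lim_homog_iff homogeneous_iff)
  have "mdeg t \<le> max r D" if i: "i \<in> I" and t: "Poly_Mapping.lookup ((h \<oplus>\<^bsub>L\<^esub> y) i) t \<noteq> 0" for i t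
  proof (cases "Poly_Mapping.lookup (h i) t = 0")
    case True
    then have "mdeg t \<le> D" using D[OF i, of t] i t by (simp add: L_simps lookup_add)
    then show ?thesis by simp
  next
    case False
    then show ?thesis using h[OF i, of t] by simp
  qed
  then show ?case by blast
qed

text \<open>
  A compatible family of degree at most \<open>D\<close> is determined by its component in any \<open>S i\<close> with at
  least \<open>D\<close> elements, since a monomial of degree at most \<open>D\<close> involves at most \<open>D\<close> variables.
\<close>

lemma carrier_sym_family:
  assumes x: "x \<in> carrier L"
  shows "\<exists>g. bounded_degree g \<and> x = sym_family I S g"
proof -
  obtain D where D: "\<And>i t. i \<in> I \<Longrightarrow> Poly_Mapping.lookup (x i) t \<noteq> 0 \<Longrightarrow> mdeg t \<le> D"
    using carrier_degree_bound[OF x] by blast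
  obtain i0 where i0: "i0 \<in> I" "D \<le> card (S i0)" using unbounded by blast
  define rep where "rep M = (SOME t. Poly_Mapping.keys t \<subseteq> S i0 \<and> mtype t = M)" for M
  \<comment> \<open>For other \<open>M\<close> the set \<open>S i0\<close> may contain no monomial
    of type \<open>M\<close>. The value 0 makes \<open>g\<close> bounded and agrees with the
    vanishing of all coefficients of \<open>x\<close> beyond degree \<open>D\<close>.\<close>
  define g where "g M = (if 0 \<notin># M \<and> sum_mset M \<le> D
      then Poly_Mapping.lookup (x i0) (rep M) else 0)" for M
  have rep: "Poly_Mapping.keys (rep M) \<subseteq> S i0 \<and> mtype (rep M) = M"
    if "0 \<notin># M" "sum_mset M \<le> D" for M
    unfolding rep_def
    by (rule someI_ex, rule exists_mtype) (use that i0(2) size_le_sum_mset[of M] in auto)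
  have g: "bounded_degree g" unfolding bounded_degree_def g_def by (metis (mono_tags))
  have comp: "x i \<in> sym_polys (S i)" if "i \<in> I" for i
    using lim_carrier_component[OF x that] by simp
  have restr: "Poly_Mapping.lookup (x l) t = Poly_Mapping.lookup (x i) t"
    if "i \<in> I" "l \<in> I" "i \<le> l" "Poly_Mapping.keys t \<subseteq> S i" for i l t
  proof -
    have "x i = set_zero (S l - S i) (x l)"
      using lim_carrier_compatible[OF x that(1-3)] f_eq[OF that(1-3) comp[OF that(2)]] by simp
    moreover have "Poly_Mapping.keys t \<inter> (S l - S i) = {}" using that(4) by blast
    ultimately show ?thesis by (simp add: lookup_set_zero)
  qed
  have "x i = sym_poly g (S i)" if i: "i \<in> I" for i
  proof (rule poly_mapping_eqI)
    fix t
    \<comment> \<open>The indices \<open>i\<close> and \<open>i0\<close> need not be comparable, so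
      coefficients are compared at a common upper bound.\<close>
    obtain l where l: "l \<in> I" "i \<le> l" "i0 \<le> l" using upper[OF i i0(1)] by blast
    consider "\<not> Poly_Mapping.keys t \<subseteq> S i" | "Poly_Mapping.keys t \<subseteq> S i" "D < mdeg t"
      | "Poly_Mapping.keys t \<subseteq> S i" "mdeg t \<le> D" by fastforce
    then show "Poly_Mapping.lookup (x i) t = Poly_Mapping.lookup (sym_poly g (S i)) t"
    proof cases
      case 1
      then have "Poly_Mapping.lookup (x i) t = 0"
        using comp[OF i] unfolding sym_polys_def pvars_subset_iff by blast
      then show ?thesis using 1 by (simp add: lookup_sym_poly fin[OF i] g)
    next
      case 2
      then have "Poly_Mapping.lookup (x i) t = 0" using D[OF i, of t] by (meson not_less)
      then show ?thesis using 2 by (simp add: lookup_sym_poly fin[OF i] g g_def sum_mset_mtype)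
    next
      case 3
      let ?u = "rep (mtype t)"
      have u: "Poly_Mapping.keys ?u \<subseteq> S i0" "mtype ?u = mtype t"
        using rep[of "mtype t"] 3 by (auto simp: zero_notin_mtype sum_mset_mtype)
      \<comment> \<open>In \<open>S l\<close> the symmetry of \<open>x l\<close> equates the
        coefficients of \<open>t\<close> and \<open>?u\<close>, which have the same type;
        \<open>restr\<close> relates them to the coefficients in \<open>x i\<close> and
        \<open>x i0\<close>.\<close>
      have "Poly_Mapping.keys t \<subseteq> S l" "Poly_Mapping.keys ?u \<subseteq> S l"
        using 3(1) u(1) mono[OF i l(1,2)] mono[OF i0(1) l(1,3)] by blast+
      then have "Poly_Mapping.lookup (x l) t = Poly_Mapping.lookup (x l) ?u"
        using comp[OF l(1)] u(2) unfolding sym_polys_iff by metis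
      then have "Poly_Mapping.lookup (x i) t = Poly_Mapping.lookup (x i0) ?u"
        using restr[OF i l(1,2) 3(1)] restr[OF i0(1) l(1,3) u(1)] by simp
      then show ?thesis
        using 3 by (simp add: lookup_sym_poly fin[OF i] g g_def zero_notin_mtype sum_mset_mtype)
    qed
  qed
  moreover have "x \<in> extensional I" by (rule lim_carrier_ext[OF x])
  ultimately have "x = sym_family I S g"
    unfolding sym_family_def by (intro extensionalityI[of _ I]) auto
  with g show ?thesis by blast
qed

lemma sym_family_inject:
  assumes "bounded_degree g" "bounded_degree g'" "sym_family I S g = sym_family I S g'"
    and M: "0 \<notin># M"
  shows "g M = g' M"
proof -
  obtain i where i: "i \<in> I" "size M \<le> card (S i)" using unbounded by blast
  have "sym_poly g (S i) = sym_poly g' (S i)"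
    using fun_cong[OF assms(3), of i] i(1) by (simp add: sym_family_def)
  then show ?thesis by (rule sym_poly_inject[OF fin[OF i(1)] assms(1,2) _ M i(2)])
qed

end

section \<open>Maps between limits that set variables to zero\<close>

lemma surj_graded_ring_hom_cong:
  assumes "surj_graded_ring_hom R S h" "\<And>x. x \<in> carrier R \<Longrightarrow> h' x = h x"
  shows "surj_graded_ring_hom R S h'"
  using assms graded_ring_hom_cong[of R S h h'] image_cong[of "carrier R" "carrier R" h' h]
  unfolding surj_graded_ring_hom_def by simp

text \<open>A component over \<open>T j\<close> is obtained from the source component at
  \<open>\<tau> j\<close> by discarding the surplus variables. For \<open>phi\<close> and
  \<open>psi\<close> the map \<open>\<tau>\<close> is the identity; for \<open>H_map\<close> and
  \<open>V_map\<close> it sends an index to its finite set of indeterminates.\<close>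

locale sym_system_restriction =
  A: sym_system I S f + B: sym_system J T g
  for I :: "'i::order set" and S :: "'i \<Rightarrow> 'x set" and f
    and J :: "'j::order set" and T :: "'j \<Rightarrow> 'x set" and g +
  fixes \<tau> :: "'j \<Rightarrow> 'i"
  assumes \<tau>_in: "j \<in> J \<Longrightarrow> \<tau> j \<in> I"
    and \<tau>_mono: "i \<in> J \<Longrightarrow> j \<in> J \<Longrightarrow> i \<le> j \<Longrightarrow> \<tau> i \<le> \<tau> j"
    and \<tau>_sub: "j \<in> J \<Longrightarrow> T j \<subseteq> S (\<tau> j)"
begin

definition restriction :: "('i \<Rightarrow> 'x zpoly) \<Rightarrow> 'j \<Rightarrow> 'x zpoly" where
  "restriction x = (\<lambda>j\<in>J. set_zero (S (\<tau> j) - T j) (x (\<tau> j)))"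

lemma restriction_sym_family:
  assumes "bounded_degree c"
  shows "restriction (sym_family I S c) = sym_family J T c"
  unfolding restriction_def sym_family_def
proof (rule restrict_ext)
  fix j assume j: "j \<in> J"
  have "S (\<tau> j) - (S (\<tau> j) - T j) = T j" using \<tau>_sub[OF j] by blast
  then show "set_zero (S (\<tau> j) - T j) ((\<lambda>i\<in>I. sym_poly c (S i)) (\<tau> j)) = sym_poly c (T j)"
    using j by (simp add: \<tau>_in set_zero_sym_poly A.fin assms)
qed

lemma restriction_hom: "graded_ring_hom A.L B.L restriction"
  unfolding restriction_def
proof (rule B.graded_ring_hom_limI[OF A.graded_ring_L])
  fix j assume j: "j \<in> J"
  have "S (\<tau> j) - (S (\<tau> j) - T j) = T j" using \<tau>_sub[OF j] by blast
  then show "graded_ring_hom A.L (sym_ring (T j)) (\<lambda>x. set_zero (S (\<tau> j) - T j) (x (\<tau> j)))"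
    using graded_ring_hom_comp[OF A.graded_ring_hom_component[OF \<tau>_in[OF j]]
        graded_ring_hom_set_zero] by blast
next
  fix i j x assume ij: "i \<in> J" "j \<in> J" "i \<le> j" and x: "x \<in> carrier A.L"
  note \<tau>' = \<tau>_in[OF ij(1)] \<tau>_in[OF ij(2)] \<tau>_mono[OF ij]
  have xj: "x (\<tau> j) \<in> sym_polys (S (\<tau> j))"
    using A.lim_carrier_component[OF x \<tau>'(2)] by simp
  have "x (\<tau> i) = set_zero (S (\<tau> j) - S (\<tau> i)) (x (\<tau> j))"
    using A.lim_carrier_compatible[OF x \<tau>'] A.f_eq[OF \<tau>' xj] by simp
  moreover have "set_zero (S (\<tau> j) - T j) (x (\<tau> j)) \<in> sym_polys (T j)"
    by (rule sym_polys_set_zero[OF xj]) (use \<tau>_sub[OF ij(2)] in blast)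
  \<comment> \<open>Both sides equal \<open>S (\<tau> j) - T i\<close>: the two ways down from
    \<open>S (\<tau> j)\<close> to \<open>T i\<close> kill the same variables.\<close>
  moreover have "(T j - T i) \<union> (S (\<tau> j) - T j)
      = (S (\<tau> i) - T i) \<union> (S (\<tau> j) - S (\<tau> i))"
    using \<tau>_sub[OF ij(1)] \<tau>_sub[OF ij(2)] B.mono[OF ij] A.mono[OF \<tau>'] by blast
  ultimately show "g j i (set_zero (S (\<tau> j) - T j) (x (\<tau> j))) = set_zero (S (\<tau> i) - T i) (x (\<tau> i))"
    using ij by (simp add: B.f_eq set_zero_set_zero)
qed

lemma surj_restriction: "surj_graded_ring_hom A.L B.L restriction"
  unfolding surj_graded_ring_hom_def
proof (intro conjI restriction_hom subset_antisym)
  show "restriction ` carrier A.L \<subseteq> carrier B.L"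
    using ring_hom_closed[OF graded_ring_hom_ring_hom[OF restriction_hom]] by blast
  show "carrier B.L \<subseteq> restriction ` carrier A.L"
  proof
    fix y assume "y \<in> carrier B.L"
    then obtain c where c: "bounded_degree c" "y = sym_family J T c"
      using B.carrier_sym_family by blast
    then have "y = restriction (sym_family I S c)" by (simp add: restriction_sym_family)
    then show "y \<in> restriction ` carrier A.L" using A.sym_family_in_carrier[OF c(1)] by blast
  qed
qed

end

text \<open>
  All components of an element of the limit come from the same function on exponent types as the
  component at the least index \<open>k0\<close>.
\<close>

lemma iterated_limit_iso:
  fixes K :: "'k::order set"
  assumes A: "sym_system I S f"
    and B: "\<And>k. k \<in> K \<Longrightarrow> sym_system J (T k) (g k)"
    and dir: "directed_graded_family K (\<lambda>k. graded_lim J (\<lambda>j. sym_ring (T k j)) (g k)) p"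
    and p: "\<And>k l c. k \<in> K \<Longrightarrow> l \<in> K \<Longrightarrow> k \<le> l \<Longrightarrow> bounded_degree c \<Longrightarrow>
      p l k (sym_family J (T l) c) = sym_family J (T k) c"
    and k0: "k0 \<in> K" "\<And>k. k \<in> K \<Longrightarrow> k0 \<le> k"
    and h: "\<And>k. k \<in> K \<Longrightarrow> graded_ring_hom (graded_lim I (\<lambda>i. sym_ring (S i)) f)
      (graded_lim J (\<lambda>j. sym_ring (T k j)) (g k)) (h k)"
    and h_family: "\<And>k c. k \<in> K \<Longrightarrow> bounded_degree c \<Longrightarrow>
      h k (sym_family I S c) = sym_family J (T k) c"
  shows "graded_ring_iso (graded_lim I (\<lambda>i. sym_ring (S i)) f)
    (graded_lim K (\<lambda>k. graded_lim J (\<lambda>j. sym_ring (T k j)) (g k)) p) (\<lambda>x. \<lambda>k\<in>K. h k x)"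
proof -
  interpret A: sym_system I S f by (rule A)
  interpret C: graded_family K "\<lambda>k. graded_lim J (\<lambda>j. sym_ring (T k j)) (g k)" p
    by unfold_locales (rule dir)
  interpret B0: sym_system J "T k0" "g k0" by (rule B[OF k0(1)])
  have hom: "graded_ring_hom A.L C.L (\<lambda>x. \<lambda>k\<in>K. h k x)"
  proof (rule C.graded_ring_hom_limI[OF A.graded_ring_L h])
    fix k l x assume "k \<in> K" "l \<in> K" "k \<le> l" and x: "x \<in> carrier A.L"
    moreover obtain c where "bounded_degree c" "x = sym_family I S c"
      using A.carrier_sym_family[OF x] by blast
    ultimately show "p l k (h l x) = h k x" by (simp add: h_family p)
  qed
  have "bij_betw (\<lambda>x. \<lambda>k\<in>K. h k x) (carrier A.L) (carrier C.L)"
  proof (rule bij_betw_imageI)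
    show "inj_on (\<lambda>x. \<lambda>k\<in>K. h k x) (carrier A.L)"
    proof (rule inj_onI)
      fix x y assume xy: "x \<in> carrier A.L" "y \<in> carrier A.L" "(\<lambda>k\<in>K. h k x) = (\<lambda>k\<in>K. h k y)"
      obtain c d where cd: "bounded_degree c" "x = sym_family I S c"
        "bounded_degree d" "y = sym_family I S d"
        using A.carrier_sym_family xy by metis
      have "sym_family J (T k0) c = sym_family J (T k0) d"
        using fun_cong[OF xy(3), of k0] k0(1) cd by (simp add: h_family)
      then show "x = y"
        unfolding cd using B0.sym_family_inject[OF cd(1,3)] by (intro sym_family_cong)
    qed
    show "(\<lambda>x. \<lambda>k\<in>K. h k x) ` carrier A.L = carrier C.L"
    proof (rule subset_antisym)
      show "(\<lambda>x. \<lambda>k\<in>K. h k x) ` carrier A.L \<subseteq> carrier C.L"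
        using ring_hom_closed[OF graded_ring_hom_ring_hom[OF hom]] by blast
      show "carrier C.L \<subseteq> (\<lambda>x. \<lambda>k\<in>K. h k x) ` carrier A.L"
      proof
        fix y assume y: "y \<in> carrier C.L"
        have y_family: "\<exists>c. bounded_degree c \<and> y k = sym_family J (T k) c" if "k \<in> K" for k
          using sym_system.carrier_sym_family[OF B[OF that] C.lim_carrier_component[OF y that]] .
        obtain c where c: "bounded_degree c" "y k0 = sym_family J (T k0) c"
          using y_family[OF k0(1)] by blast
        have "y k = sym_family J (T k) c" if k: "k \<in> K" for k
        proof -
          obtain d where d: "bounded_degree d" "y k = sym_family J (T k) d"
            using y_family[OF k] by blast
          \<comment> \<open>The variable sets \<open>T k0 j\<close> are unbounded already for the
            fixed \<open>k0\<close>, so this equality forces \<open>c\<close> and \<open>d\<close>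
            to agree on all multisets without 0, and thus at \<open>k\<close> as well.\<close>
          have "sym_family J (T k0) d = sym_family J (T k0) c"
            using C.lim_carrier_compatible[OF y k0(1) k k0(2)[OF k]] p[OF k0(1) k k0(2)[OF k] d(1)]
              c(2) d(2) by simp
          then show ?thesis
            unfolding d(2) using B0.sym_family_inject[OF d(1) c(1)] by (intro sym_family_cong)
        qed
        then have "y = (\<lambda>k\<in>K. h k (sym_family I S c))"
          using C.lim_carrier_ext[OF y] c(1)
          by (intro extensionalityI[of _ K]) (auto simp: h_family)
        then show "y \<in> (\<lambda>x. \<lambda>k\<in>K. h k x) ` carrier A.L"
          using A.sym_family_in_carrier[OF c(1)] by blast
      qed
    qed
  qed
  then show ?thesis by (rule graded_ring_isoI[OF hom])
qed

section \<open>The rings of the theorem\<close>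

lemma set_zero_empty [simp]: "set_zero {} P = P"
  by (rule poly_mapping_eqI) (simp add: lookup_set_zero)

lemma chain_chain:
  assumes "i \<le> j" "j \<le> l"
  shows "chain g j i (chain g l j x) = chain g l i x"
  using assms(2)
proof (induction l arbitrary: x rule: dec_induct)
  case base
  show ?case by (simp add: chain_refl)
next
  case (step l)
  then show ?case using assms(1) by (simp add: chain_Suc)
qed

lemma chain_v_fin:
  assumes "k1 \<le> k2"
  shows "chain (v_fin n m) k2 k1 P = set_zero (indets_upto n m k2 - indets_upto n m k1) P"
  using assms
proof (induction k2 arbitrary: P rule: dec_induct)
  case base
  show ?case by (simp add: chain_refl)
next
  case (step k)
  have "(indets_upto n m k - indets_upto n m k1) \<union> {(p, \<mu>) \<in> indets n. p \<le> m \<and> length \<mu> = Suc k}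
      = indets_upto n m (Suc k) - indets_upto n m k1"
    using step(1) by (auto simp: indets_upto_def)
  then show ?case using step by (simp add: chain_Suc v_fin_def set_zero_set_zero)
qed

lemma chain_h_fin:
  assumes "m1 \<le> m2"
  shows "chain (h_fin n k) m2 m1 P = set_zero (indets_upto n m2 k - indets_upto n m1 k) P"
  using assms
proof (induction m2 arbitrary: P rule: dec_induct)
  case base
  show ?case by (simp add: chain_refl)
next
  case (step m)
  have "(indets_upto n m k - indets_upto n m1 k) \<union> {(p, \<mu>) \<in> indets n. p = Suc m \<and> length \<mu> \<le> k}
      = indets_upto n (Suc m) k - indets_upto n m1 k"
    using step(1) by (auto simp: indets_upto_def)
  then show ?case using step by (simp add: chain_Suc h_fin_def set_zero_set_zero)
qed

lemma phi_eq:
  assumes "m1 \<le> m2"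
  shows "phi n m2 m1 x = (\<lambda>k. set_zero (indets_upto n m2 k - indets_upto n m1 k) (x k))"
proof -
  have "chain (h_seq n) m2 m1 x = (\<lambda>k. chain (h_fin n k) m2 m1 (x k))"
    using assms
  proof (induction m2 arbitrary: x rule: dec_induct)
    case base
    show ?case by (simp add: chain_refl)
  next
    case (step m)
    then show ?case by (simp add: chain_Suc h_seq_def)
  qed
  then show ?thesis by (simp add: phi_def chain_h_fin[OF assms])
qed

text \<open>For \<open>k1 = k2\<close> the chain is the identity and keeps the value of
  \<open>x\<close> at 0, while the right side is restricted to \<open>{1..}\<close>; extensionality
  of \<open>x\<close> reconciles the two. For \<open>phi\<close> the sequences are indexed by all
  naturals and the question does not arise.\<close>

lemma psi_eq:
  assumes "k1 \<le> k2" "x \<in> extensional {1..}"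
  shows "psi n k2 k1 x = (\<lambda>m\<in>{1..}. set_zero (indets_upto n m k2 - indets_upto n m k1) (x m))"
proof -
  have "chain (v_seq n) k2 k1 x = (\<lambda>m\<in>{1..}. chain (v_fin n m) k2 k1 (x m))"
    using assms
  proof (induction k2 arbitrary: x rule: dec_induct)
    case base
    then show ?case by (simp add: chain_refl extensional_restrict)
  next
    case (step k)
    have "v_seq n (Suc k) x \<in> extensional {1..}" by (simp add: v_seq_def)
    moreover have "v_seq n (Suc k) x m = v_fin n m (Suc k) (x m)" if "m \<in> {1..}" for m
      using that by (simp add: v_seq_def)
    ultimately show ?case
      using step.hyps by (simp add: chain_Suc step.IH cong: restrict_cong del: One_nat_def)
  qed
  then show ?thesis by (simp add: psi_def chain_v_fin[OF assms(1)])
qed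

section \<open>The systems of finite sets of indeterminates\<close>

lemma finite_indets_upto: "finite (indets_upto n m k)"
proof (rule finite_subset)
  show "indets_upto n m k \<subseteq> {1..m} \<times> {\<mu>. set \<mu> \<subseteq> {1..n} \<and> length \<mu> \<le> k}"
    by (auto simp: indets_upto_def indets_def)
qed (simp add: finite_lists_length_le)

lemma indets_upto_subset: "indets_upto n m k \<subseteq> indets n"
  by (auto simp: indets_upto_def)

lemma indets_upto_mono: "m \<le> m' \<Longrightarrow> k \<le> k' \<Longrightarrow> indets_upto n m k \<subseteq> indets_upto n m' k'"
  by (auto simp: indets_upto_def)

text \<open>The words of \<open>d\<close> letters 1 with \<open>d < k\<close> are distinct. Here
  \<open>1 \<le> n\<close> enters: over an empty alphabet only the empty word exists, and the number
  of indeterminates would stay at \<open>m\<close> for every \<open>k\<close>.\<close>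

lemma card_indets_upto_k:
  assumes "1 \<le> n" "1 \<le> m"
  shows "k \<le> card (indets_upto n m k)"
proof -
  have "(\<lambda>d. (1, replicate d 1)) ` {..<k} \<subseteq> indets_upto n m k"
    using assms by (auto simp: indets_upto_def indets_def)
  moreover have "inj_on (\<lambda>d. (1 :: nat, replicate d (1 :: nat))) {..<k}"
    by (auto intro!: inj_onI dest: arg_cong[of _ _ length])
  ultimately show ?thesis
    using card_mono[OF finite_indets_upto] by (metis card_image card_lessThan)
qed

lemma card_indets_upto_m: "m \<le> card (indets_upto n m k)"
proof -
  have "(\<lambda>p. (p, [])) ` {1..m} \<subseteq> indets_upto n m k"
    by (auto simp: indets_upto_def indets_def)
  moreover have "inj_on (\<lambda>p :: nat. (p, [] :: nat list)) {1..m}" by (auto intro: inj_onI)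
  ultimately show ?thesis
    using card_mono[OF finite_indets_upto] by (metis card_image card_atLeastAtMost diff_Suc_1)
qed

lemma sym_system_m:
  assumes "1 \<le> n" "1 \<le> m"
  shows "sym_system UNIV (indets_upto n m) (chain (v_fin n m))"
proof
  show "\<exists>l\<in>UNIV. i \<le> l \<and> j \<le> l" for i j :: nat by (rule bexI[of _ "max i j"]) auto
  show "\<exists>k\<in>UNIV. N \<le> card (indets_upto n m k)" for N
    using card_indets_upto_k[OF assms] by blast
qed (auto simp: finite_indets_upto chain_v_fin intro: indets_upto_mono[THEN subsetD])

lemma sym_system_k: "sym_system {1..} (\<lambda>m. indets_upto n m k) (chain (h_fin n k))"
proof
  show "\<exists>l\<in>{1..}. i \<le> l \<and> j \<le> l" if "i \<in> {1..}" for i j :: nat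
    using that by (intro bexI[of _ "max i j"]) auto
  show "\<exists>m\<in>{1..}. N \<le> card (indets_upto n m k)" for N
    \<comment> \<open>\<open>Suc N\<close> is taken because \<open>N\<close> may be 0, whereas the
      index set starts at 1.\<close>
    by (rule bexI[of _ "Suc N"]) (use card_indets_upto_m[of "Suc N" n k] in auto)
qed (auto simp: finite_indets_upto chain_h_fin intro: indets_upto_mono[THEN subsetD])

lemma sym_system_finite_subsets:
  "sym_system {S. finite S \<and> S \<subseteq> indets n} (\<lambda>S. S) (\<lambda>T S. set_zero (T - S))"
proof
  show "\<exists>U\<in>{S. finite S \<and> S \<subseteq> indets n}. S \<le> U \<and> T \<le> U"
    if "S \<in> {S. finite S \<and> S \<subseteq> indets n}" "T \<in> {S. finite S \<and> S \<subseteq> indets n}" for S T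
    using that by (intro bexI[of _ "S \<union> T"]) auto
  show "\<exists>S\<in>{S. finite S \<and> S \<subseteq> indets n}. N \<le> card S" for N
    using card_indets_upto_m[of N n 0] finite_indets_upto indets_upto_subset by blast
qed auto

lemma Lam_eq: "Lam n = graded_lim {S. finite S \<and> S \<subseteq> indets n} sym_ring (\<lambda>T S. set_zero (T - S))"
  by (simp add: Lam_def sym_functions_def)

lemma Lam_m_eq: "Lam_m n m = graded_lim UNIV (\<lambda>k. sym_ring (indets_upto n m k)) (chain (v_fin n m))"
  by (simp add: Lam_m_def Lam_fin_def)

lemma Lam_k_eq: "Lam_k n k = graded_lim {1..} (\<lambda>m. sym_ring (indets_upto n m k)) (chain (h_fin n k))"
  by (simp add: Lam_k_def Lam_fin_def)

lemma Lam_component: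
  assumes "F \<in> carrier (Lam n)" "finite S" "S \<subseteq> indets n"
  shows "F S \<in> sym_polys S"
proof -
  interpret sym_system "{S. finite S \<and> S \<subseteq> indets n}" "\<lambda>S. S" "\<lambda>T S. set_zero (T - S)"
    by (rule sym_system_finite_subsets)
  show ?thesis using lim_carrier_component[of F S] assms by (simp add: Lam_eq)
qed

section \<open>The maps and isomorphisms of the theorem\<close>

lemma
  assumes "1 \<le> n" "1 \<le> m1" "m1 \<le> m2"
  shows surj_phi: "surj_graded_ring_hom (Lam_m n m2) (Lam_m n m1) (phi n m2 m1)"
    and phi_family: "bounded_degree c \<Longrightarrow>
      phi n m2 m1 (sym_family UNIV (indets_upto n m2) c) = sym_family UNIV (indets_upto n m1) c"
proof -
  interpret sym_system_restriction UNIV "indets_upto n m2" "chain (v_fin n m2)"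
    UNIV "indets_upto n m1" "chain (v_fin n m1)" "\<lambda>k. k"
    using assms indets_upto_mono[OF assms(3) order_refl]
    by (intro sym_system_restriction.intro sym_system_m sym_system_restriction_axioms.intro) auto
  have eq: "phi n m2 m1 = restriction"
    using assms(3) by (simp add: fun_eq_iff phi_eq restriction_def)
  show "surj_graded_ring_hom (Lam_m n m2) (Lam_m n m1) (phi n m2 m1)"
    unfolding eq Lam_m_eq by (rule surj_restriction)
  show "phi n m2 m1 (sym_family UNIV (indets_upto n m2) c) = sym_family UNIV (indets_upto n m1) c"
    if "bounded_degree c"
    unfolding eq by (rule restriction_sym_family[OF that])
qed

lemma
  assumes "k1 \<le> k2"
  shows surj_psi: "surj_graded_ring_hom (Lam_k n k2) (Lam_k n k1) (psi n k2 k1)"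
    and psi_family: "bounded_degree c \<Longrightarrow>
      psi n k2 k1 (sym_family {1..} (\<lambda>m. indets_upto n m k2) c)
        = sym_family {1..} (\<lambda>m. indets_upto n m k1) c"
proof -
  interpret sym_system_restriction "{1..}" "\<lambda>m. indets_upto n m k2" "chain (h_fin n k2)"
    "{1..}" "\<lambda>m. indets_upto n m k1" "chain (h_fin n k1)" "\<lambda>m. m"
    using assms indets_upto_mono[OF order_refl assms]
    by (intro sym_system_restriction.intro sym_system_k sym_system_restriction_axioms.intro) auto
  have eq: "psi n k2 k1 x = restriction x" if "x \<in> extensional {1..}" for x
    using that assms by (simp add: psi_eq restriction_def del: One_nat_def)
  show "surj_graded_ring_hom (Lam_k n k2) (Lam_k n k1) (psi n k2 k1)"
    unfolding Lam_k_eq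
    by (rule surj_graded_ring_hom_cong[OF surj_restriction]) (rule eq[OF A.lim_carrier_ext])
  show "psi n k2 k1 (sym_family {1..} (\<lambda>m. indets_upto n m k2) c)
      = sym_family {1..} (\<lambda>m. indets_upto n m k1) c" if "bounded_degree c"
    using restriction_sym_family[OF that] by (simp add: eq sym_family_def del: One_nat_def)
qed

text \<open>The truncation of \<open>F\<close> to \<open>indets_upto n m k\<close> contains no
  indeterminate with first index above \<open>m\<close>, so \<open>set_zero\<close> changes nothing
  there and \<open>H_map\<close> merely selects components of \<open>F\<close>. In
  \<open>V_map\<close> below, the same holds for words longer than \<open>k\<close>.\<close>

lemma
  assumes "1 \<le> n" "1 \<le> m"
  shows surj_H_map: "surj_graded_ring_hom (Lam n) (Lam_m n m) (H_map n m)"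
    and H_map_family: "bounded_degree c \<Longrightarrow>
      H_map n m (sym_family {S. finite S \<and> S \<subseteq> indets n} (\<lambda>S. S) c)
        = sym_family UNIV (indets_upto n m) c"
    and H_map_apply: "F \<in> carrier (Lam n) \<Longrightarrow> H_map n m F k = F (indets_upto n m k)"
proof -
  interpret sym_system_restriction "{S. finite S \<and> S \<subseteq> indets n}" "\<lambda>S. S" "\<lambda>T S. set_zero (T - S)"
    UNIV "indets_upto n m" "chain (v_fin n m)" "indets_upto n m"
    using assms finite_indets_upto indets_upto_subset indets_upto_mono
    by (intro sym_system_restriction.intro sym_system_m sym_system_finite_subsets
        sym_system_restriction_axioms.intro) auto
  show component: "H_map n m F k = F (indets_upto n m k)" if "F \<in> carrier (Lam n)" for F k
  proof -
    have "pvars (F (indets_upto n m k)) \<subseteq> indets_upto n m k"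
      using Lam_component[OF that finite_indets_upto indets_upto_subset] by (simp add: sym_polys_def)
    then have "set_zero {(p, \<mu>) \<in> indets n. m < p} (F (indets_upto n m k))
        = set_zero {} (F (indets_upto n m k))"
      by (rule set_zero_cong) (auto simp: indets_upto_def)
    then show ?thesis by (simp add: H_map_def set_zero_family_def)
  qed
  have eq: "H_map n m F = restriction F" if "F \<in> carrier (Lam n)" for F
    using component[OF that] by (auto simp: restriction_def)
  show "surj_graded_ring_hom (Lam n) (Lam_m n m) (H_map n m)"
    unfolding Lam_m_eq Lam_eq
    by (rule surj_graded_ring_hom_cong[OF surj_restriction]) (simp add: eq Lam_eq)
  show "H_map n m (sym_family {S. finite S \<and> S \<subseteq> indets n} (\<lambda>S. S) c)
        = sym_family UNIV (indets_upto n m) c" if "bounded_degree c"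
    using restriction_sym_family[OF that] eq A.sym_family_in_carrier[OF that]
    by (simp add: Lam_eq)
qed

lemma
  shows surj_V_map: "surj_graded_ring_hom (Lam n) (Lam_k n k) (V_map n k)"
    and V_map_family: "bounded_degree c \<Longrightarrow>
      V_map n k (sym_family {S. finite S \<and> S \<subseteq> indets n} (\<lambda>S. S) c)
        = sym_family {1..} (\<lambda>m. indets_upto n m k) c"
    and V_map_apply: "F \<in> carrier (Lam n) \<Longrightarrow> 1 \<le> m \<Longrightarrow> V_map n k F m = F (indets_upto n m k)"
proof -
  interpret sym_system_restriction "{S. finite S \<and> S \<subseteq> indets n}" "\<lambda>S. S" "\<lambda>T S. set_zero (T - S)"
    "{1..}" "\<lambda>m. indets_upto n m k" "chain (h_fin n k)" "\<lambda>m. indets_upto n m k"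
    using finite_indets_upto indets_upto_subset indets_upto_mono
    by (intro sym_system_restriction.intro sym_system_k sym_system_finite_subsets
        sym_system_restriction_axioms.intro) auto
  show component: "V_map n k F m = F (indets_upto n m k)" if "F \<in> carrier (Lam n)" "1 \<le> m" for F m
  proof -
    have "pvars (F (indets_upto n m k)) \<subseteq> indets_upto n m k"
      using Lam_component[OF that(1) finite_indets_upto indets_upto_subset]
      by (simp add: sym_polys_def)
    then have "set_zero {(p, \<mu>) \<in> indets n. k < length \<mu>} (F (indets_upto n m k))
        = set_zero {} (F (indets_upto n m k))"
      by (rule set_zero_cong) (auto simp: indets_upto_def)
    then show ?thesis using that(2) by (simp add: V_map_def set_zero_family_def)
  qed
  have eq: "V_map n k F = restriction F" if "F \<in> carrier (Lam n)" for F
  proof (rule extensionalityI[of _ "{1..}"])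
    show "V_map n k F \<in> extensional {1..}" by (simp add: V_map_def)
    show "restriction F \<in> extensional {1..}" unfolding restriction_def by (rule restrict_extensional)
  qed (use component[OF that] in \<open>auto simp: restriction_def simp del: One_nat_def\<close>)
  show "surj_graded_ring_hom (Lam n) (Lam_k n k) (V_map n k)"
    unfolding Lam_k_eq Lam_eq
    by (rule surj_graded_ring_hom_cong[OF surj_restriction]) (simp add: eq Lam_eq)
  show "V_map n k (sym_family {S. finite S \<and> S \<subseteq> indets n} (\<lambda>S. S) c)
        = sym_family {1..} (\<lambda>m. indets_upto n m k) c" if "bounded_degree c"
    using restriction_sym_family[OF that] eq A.sym_family_in_carrier[OF that]
    by (simp add: Lam_eq)
qed

lemma directed_phi:
  assumes "1 \<le> n"
  shows "directed_graded_family {1..} (Lam_m n) (phi n)"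
  unfolding directed_graded_family_def
proof (intro conjI ballI impI)
  show "\<exists>l\<in>{1..}. i \<le> l \<and> j \<le> l" if "i \<in> {1..}" for i j :: nat
    using that by (intro bexI[of _ "max i j"]) auto
  show "graded_ring_hom (Lam_m n j) (Lam_m n i) (phi n j i)" if "i \<in> {1..}" "i \<le> j" for i j
    using surj_phi[OF assms] that by (simp add: surj_graded_ring_hom_def)
qed (auto simp: phi_def chain_refl chain_chain)

lemma directed_psi: "directed_graded_family UNIV (Lam_k n) (psi n)"
  unfolding directed_graded_family_def
proof (intro conjI ballI impI)
  show "\<exists>l\<in>UNIV. i \<le> l \<and> j \<le> l" for i j :: nat
    by (intro bexI[of _ "max i j"]) auto
  show "graded_ring_hom (Lam_k n j) (Lam_k n i) (psi n j i)" if "i \<le> j" for i j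
    using surj_psi[OF that] by (simp add: surj_graded_ring_hom_def)
qed (auto simp: psi_def chain_refl chain_chain)

lemma Lam_iso_lim_Lam_m:
  assumes "1 \<le> n"
  shows "graded_ring_iso (Lam n) (lim_Lam_m n) (\<lambda>F. \<lambda>m\<in>{1..}. H_map n m F)"
  unfolding lim_Lam_m_def Lam_eq Lam_m_eq
proof (rule iterated_limit_iso[where ?k0.0 = 1])
  show "directed_graded_family {1..}
      (\<lambda>m. graded_lim UNIV (\<lambda>k. sym_ring (indets_upto n m k)) (chain (v_fin n m))) (phi n)"
    using directed_phi[OF assms] unfolding Lam_m_eq .
  show "graded_ring_hom (graded_lim {S. finite S \<and> S \<subseteq> indets n} sym_ring (\<lambda>T S. set_zero (T - S)))
      (graded_lim UNIV (\<lambda>k. sym_ring (indets_upto n m k)) (chain (v_fin n m))) (H_map n m)"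
    if "m \<in> {1..}" for m
    using surj_H_map[OF assms, of m] that unfolding Lam_m_eq Lam_eq surj_graded_ring_hom_def by simp
qed (use assms in \<open>auto simp: sym_system_finite_subsets sym_system_m phi_family H_map_family\<close>)

lemma Lam_iso_lim_Lam_k:
  "graded_ring_iso (Lam n) (lim_Lam_k n) (\<lambda>F. \<lambda>k\<in>UNIV. V_map n k F)"
  unfolding lim_Lam_k_def Lam_eq Lam_k_eq
proof (rule iterated_limit_iso[where ?k0.0 = 0])
  show "directed_graded_family UNIV
      (\<lambda>k. graded_lim {1..} (\<lambda>m. sym_ring (indets_upto n m k)) (chain (h_fin n k))) (psi n)"
    using directed_psi unfolding Lam_k_eq .
  show "graded_ring_hom (graded_lim {S. finite S \<and> S \<subseteq> indets n} sym_ring (\<lambda>T S. set_zero (T - S)))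
      (graded_lim {1..} (\<lambda>m. sym_ring (indets_upto n m k)) (chain (h_fin n k))) (V_map n k)" for k
    using surj_V_map[of n k] unfolding Lam_k_eq Lam_eq surj_graded_ring_hom_def by simp
qed (auto simp: sym_system_finite_subsets sym_system_k psi_family V_map_family simp del: One_nat_def)

theorem theorem2:
  fixes n :: nat
  assumes "n \<ge> 1"
  shows
    "(\<forall>m1 m2. 1 \<le> m1 \<and> m1 \<le> m2 \<longrightarrow>
        surj_graded_ring_hom (Lam_m n m2) (Lam_m n m1) (phi n m2 m1)) \<and>
     (\<forall>k1 k2. k1 \<le> k2 \<longrightarrow>
        surj_graded_ring_hom (Lam_k n k2) (Lam_k n k1) (psi n k2 k1)) \<and>
     directed_graded_family {1..} (Lam_m n) (phi n) \<and>
     directed_graded_family UNIV (Lam_k n) (psi n) \<and>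
     (\<exists>\<Phi>. graded_ring_iso (Lam n) (lim_Lam_m n) \<Phi> \<and>
        (\<forall>F\<in>carrier (Lam n). \<forall>m\<ge>1. \<forall>k. \<Phi> F m k = F (indets_upto n m k))) \<and>
     (\<exists>\<Psi>. graded_ring_iso (Lam n) (lim_Lam_k n) \<Psi> \<and>
        (\<forall>F\<in>carrier (Lam n). \<forall>m\<ge>1. \<forall>k. \<Psi> F k m = F (indets_upto n m k))) \<and>
     (\<forall>m\<ge>1. surj_graded_ring_hom (Lam n) (Lam_m n m) (H_map n m)) \<and>
     (\<forall>k. surj_graded_ring_hom (Lam n) (Lam_k n k) (V_map n k))"
proof (intro conjI allI impI)
  show "\<exists>\<Phi>. graded_ring_iso (Lam n) (lim_Lam_m n) \<Phi> \<and>
      (\<forall>F\<in>carrier (Lam n). \<forall>m\<ge>1. \<forall>k. \<Phi> F m k = F (indets_upto n m k))"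
    using Lam_iso_lim_Lam_m[OF assms] H_map_apply[OF assms]
    by (intro exI[of _ "\<lambda>F. \<lambda>m\<in>{1..}. H_map n m F"]) simp
  show "\<exists>\<Psi>. graded_ring_iso (Lam n) (lim_Lam_k n) \<Psi> \<and>
      (\<forall>F\<in>carrier (Lam n). \<forall>m\<ge>1. \<forall>k. \<Psi> F k m = F (indets_upto n m k))"
    using Lam_iso_lim_Lam_k[of n] V_map_apply
    by (intro exI[of _ "\<lambda>F. \<lambda>k\<in>UNIV. V_map n k F"]) simp
qed (use assms surj_phi surj_psi directed_phi directed_psi surj_H_map surj_V_map in auto)

end
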